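(* All grim reapers of $\mathbb{H}^2\times\mathbb{R}$ are embedded surfaces. That is, every connected $\delta$-grim reaper, $\delta\in\{\mathrm{v},\mathrm{p},\mathrm{h},c_+,c_-\}$, of vertical, parabolic or hyperbolic type in $\mathbb{H}^2\times\mathbb{R}$ is an embedded surface (equivalently, its maximal generating curve is embedded, i.e. its image has no self-intersections).
   Context: $\mathbb{H}^2\times\mathbb{R}$ is $\{(x,y,z)\in\mathbb{R}^3: y>0\}$ with metric $\frac{dx^2+dy^2}{y^2}+dz^2$. For an orientable immersed surface $\Sigma$ with unit normal $N$, $H$ denotes the mean curvature with respect to $N$, i.e. half the trace of the second fundamental form $\langle N,\overline\nabla_{\cdot}\,\cdot\rangle$. For a vector field $X$ on $\mathbb{H}^2\times\mathbb{R}$ consider the equation $H=\langle N,X\rangle$ on $\Sigma$. A surface satisfying it is called a v-translator if $X=\partial_z$, a p-translator if $X=\partial_x$, an h-translator if $X=x\partial_x+y\partial_y$; the equations with $X=\partial_y$ and $X=-\partial_y$ define the $c_+$ and $c_-$ types respectively. One-parameter groups of translations: vertical $(x,y,z)\mapsto(x,y,z+t)$; parabolic $(x,y,z)\mapsto(x+t,y,z)$; hyperbolic $(x,y,z)\mapsto(e^tx,e^ty,z)$, $t\in\mathbb{R}$. A vertical (resp. parabolic, hyperbolic) $\delta$-grim reaper is a surface of type $\delta\in\{\mathrm{v},\mathrm{p},\mathrm{h},c_+,c_-\}$ invariant by the whole group of vertical (resp. parabolic, hyperbolic) translations. This gives fifteen types, all of which are called grim reapers. Such a surface is parametrized, for vertical,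 parabolic and hyperbolic invariance respectively, by $(x(s),y(s),t)$, $(t,y(s),z(s))$, $(e^t\cos r(s),e^t\sin r(s),z(s))$ with $r(s)\in(0,\pi)$; the generating curve is $(x(s),y(s))$, $(y(s),z(s))$, $(\cos r(s),\sin r(s),z(s))$ respectively, and it is taken to be a maximal solution of the resulting ODE. *)

theory Defs
  imports "HOL-Analysis.Analysis"
begin

section \<open>Smooth maps and immersions in coordinates\<close>

definition partial_deriv :: "'n::finite \<Rightarrow> (real^'n \<Rightarrow> 'b::real_normed_vector) \<Rightarrow> real^'n \<Rightarrow> 'b" where
  "partial_deriv i f p = vector_derivative (\<lambda>h. f (p + h *\<^sub>R axis i 1)) (at 0)"

primrec iterated_partial ::
    "'n::finite list \<Rightarrow> (real^'n \<Rightarrow> 'b::real_normed_vector) \<Rightarrow> real^'n \<Rightarrow> 'b" where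
  "iterated_partial [] f = f"
| "iterated_partial (i # is) f = partial_deriv i (iterated_partial is f)"

text \<open>Smoothness on an open set: all iterated partial derivatives exist and are continuous.
  The existence has to be demanded separately, since \<^const>\<open>vector_derivative\<close> is total.\<close>

definition smooth_on :: "(real^'n::finite) set \<Rightarrow> (real^'n \<Rightarrow> 'b::real_normed_vector) \<Rightarrow> bool" where
  "smooth_on U f \<longleftrightarrow> open U \<and>
     (\<forall>is. continuous_on U (iterated_partial is f) \<and>
        (\<forall>i. \<forall>p\<in>U. (\<lambda>h. iterated_partial is f (p + h *\<^sub>R axis i 1)) differentiable (at 0)))"

section \<open>The Riemannian manifold $H^2 \times R$\<close>

definition HR :: "(real^3) set" where
  "HR = {p. p $ 2 > 0}"

definition HR_metric :: "real^3 \<Rightarrow> real^3^3" where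
  "HR_metric p = (\<chi> i j. if i \<noteq> j then 0 else if i = 3 then 1 else 1 / (p $ 2)\<^sup>2)"

definition metric_inner :: "real^3 \<Rightarrow> real^3 \<Rightarrow> real^3 \<Rightarrow> real" where
  "metric_inner p v w = (\<Sum>i\<in>UNIV. \<Sum>j\<in>UNIV. HR_metric p $ i $ j * v $ i * w $ j)"

text \<open>Christoffel symbols $\Gamma^k_{ij}$ of the Levi-Civita connection.\<close>

definition christoffel :: "real^3 \<Rightarrow> 3 \<Rightarrow> 3 \<Rightarrow> 3 \<Rightarrow> real" where
  "christoffel p k i j = (1 / 2) * (\<Sum>l\<in>UNIV. matrix_inv (HR_metric p) $ k $ l *
     (partial_deriv i (\<lambda>q. HR_metric q $ j $ l) p
      + partial_deriv j (\<lambda>q. HR_metric q $ i $ l) p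
      - partial_deriv l (\<lambda>q. HR_metric q $ i $ j) p))"

section \<open>Parametrized surfaces and their mean curvature\<close>

definition immersed_surface :: "(real^2) set \<Rightarrow> (real^2 \<Rightarrow> real^3) \<Rightarrow> bool" where
  "immersed_surface U \<Psi> \<longleftrightarrow>
     smooth_on U \<Psi> \<and> \<Psi> ` U \<subseteq> HR \<and> (\<forall>q\<in>U. inj (frechet_derivative \<Psi> (at q)))"

definition unit_normal :: "(real^2) set \<Rightarrow> (real^2 \<Rightarrow> real^3) \<Rightarrow> (real^2 \<Rightarrow> real^3) \<Rightarrow> bool" where
  "unit_normal U \<Psi> N \<longleftrightarrow> continuous_on U N \<and>
     (\<forall>q\<in>U. metric_inner (\<Psi> q) (N q) (N q) = 1 \<and>
        (\<forall>a. metric_inner (\<Psi> q) (N q) (partial_deriv a \<Psi> q) = 0))"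

definition first_fundamental :: "(real^2 \<Rightarrow> real^3) \<Rightarrow> real^2 \<Rightarrow> real^2^2" where
  "first_fundamental \<Psi> q =
     (\<chi> a b. metric_inner (\<Psi> q) (partial_deriv a \<Psi> q) (partial_deriv b \<Psi> q))"

text \<open>The ambient covariant derivative of the coordinate field $\partial_b\Psi$ in the direction
  $\partial_a\Psi$.\<close>

definition cov_deriv :: "(real^2 \<Rightarrow> real^3) \<Rightarrow> 2 \<Rightarrow> 2 \<Rightarrow> real^2 \<Rightarrow> real^3" where
  "cov_deriv \<Psi> a b q = (\<chi> k. partial_deriv a (partial_deriv b \<Psi>) q $ k
     + (\<Sum>i\<in>UNIV. \<Sum>j\<in>UNIV. christoffel (\<Psi> q) k i j
          * partial_deriv a \<Psi> q $ i * partial_deriv b \<Psi> q $ j))"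

definition second_fundamental ::
    "(real^2 \<Rightarrow> real^3) \<Rightarrow> (real^2 \<Rightarrow> real^3) \<Rightarrow> real^2 \<Rightarrow> real^2^2" where
  "second_fundamental \<Psi> N q = (\<chi> a b. metric_inner (\<Psi> q) (N q) (cov_deriv \<Psi> a b q))"

text \<open>The trace is taken with respect to the induced metric.\<close>

definition mean_curvature :: "(real^2 \<Rightarrow> real^3) \<Rightarrow> (real^2 \<Rightarrow> real^3) \<Rightarrow> real^2 \<Rightarrow> real" where
  "mean_curvature \<Psi> N q =
     trace (matrix_inv (first_fundamental \<Psi> q) ** second_fundamental \<Psi> N q) / 2"

text \<open>Both sides of $H = \langle N, X\rangle$ change sign with $N$, so the choice of the
  unit normal is immaterial.\<close>

definition soliton :: "(real^3 \<Rightarrow> real^3) \<Rightarrow> (real^2) set \<Rightarrow> (real^2 \<Rightarrow> real^3) \<Rightarrow> bool" where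
  "soliton X U \<Psi> \<longleftrightarrow> immersed_surface U \<Psi> \<and>
     (\<exists>N. unit_normal U \<Psi> N \<and>
        (\<forall>q\<in>U. mean_curvature \<Psi> N q = metric_inner (\<Psi> q) (N q) (X (\<Psi> q))))"

text \<open>The image is an embedded surface: around each of its points it is a single sheet,
  parametrized homeomorphically by a restriction of the immersion. This does not ask the
  immersion itself to be injective, so that a closed generating curve, traversed repeatedly
  by its maximal parametrization, is not excluded by definition.\<close>

definition embedded_surface :: "(real^2) set \<Rightarrow> (real^2 \<Rightarrow> real^3) \<Rightarrow> bool" where
  "embedded_surface U \<Psi> \<longleftrightarrow> immersed_surface U \<Psi> \<and>
     (\<forall>p\<in>\<Psi> ` U. \<exists>V W \<Phi>. open V \<and> p \<in> V \<and> open W \<and> W \<subseteq> U \<and>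
        homeomorphism W (\<Psi> ` U \<inter> V) \<Psi> \<Phi>)"

text \<open>A curve without self-intersections: injective, or a simple closed curve.\<close>

definition no_self_intersections :: "real set \<Rightarrow> (real \<Rightarrow> 'a) \<Rightarrow> bool" where
  "no_self_intersections I \<gamma> \<longleftrightarrow> inj_on \<gamma> I \<or>
     (I = UNIV \<and> (\<exists>T>0. (\<forall>s. \<gamma> (s + T) = \<gamma> s) \<and> inj_on \<gamma> {0..<T}))"

section \<open>Grim reapers\<close>

datatype soliton_type = V_type | P_type | H_type | C_plus | C_minus

fun soliton_field :: "soliton_type \<Rightarrow> real^3 \<Rightarrow> real^3" where
  "soliton_field V_type p = vector [0, 0, 1]"
| "soliton_field P_type p = vector [1, 0, 0]"
| "soliton_field H_type p = vector [p $ 1, p $ 2, 0]"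
| "soliton_field C_plus p = vector [0, 1, 0]"
| "soliton_field C_minus p = vector [0, -1, 0]"

datatype translation_type = Vertical | Parabolic | Hyperbolic

fun translation :: "translation_type \<Rightarrow> real \<Rightarrow> real^3 \<Rightarrow> real^3" where
  "translation Vertical t p = vector [p $ 1, p $ 2, p $ 3 + t]"
| "translation Parabolic t p = vector [p $ 1 + t, p $ 2, p $ 3]"
| "translation Hyperbolic t p = vector [exp t * p $ 1, exp t * p $ 2, p $ 3]"

text \<open>The generating curve is described by a pair of functions: $(x, y)$, $(y, z)$ or $(r, z)$,
  according to the group. The next two functions give the admissible values of the pair and
  the corresponding point of a slice transversal to the orbits.\<close>

fun profile_domain :: "translation_type \<Rightarrow> (real^2) set" where
  "profile_domain Vertical = {c. c $ 2 > 0}"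
| "profile_domain Parabolic = {c. c $ 1 > 0}"
| "profile_domain Hyperbolic = {c. 0 < c $ 1 \<and> c $ 1 < pi}"

fun profile_point :: "translation_type \<Rightarrow> real^2 \<Rightarrow> real^3" where
  "profile_point Vertical c = vector [c $ 1, c $ 2, 0]"
| "profile_point Parabolic c = vector [0, c $ 1, c $ 2]"
| "profile_point Hyperbolic c = vector [cos (c $ 1), sin (c $ 1), c $ 2]"

definition generating_curve :: "translation_type \<Rightarrow> (real \<Rightarrow> real^2) \<Rightarrow> real \<Rightarrow> real^3" where
  "generating_curve G c s = profile_point G (c s)"

definition sweep :: "translation_type \<Rightarrow> (real \<Rightarrow> real^2) \<Rightarrow> real^2 \<Rightarrow> real^3" where
  "sweep G c q = translation G (q $ 2) (generating_curve G c (q $ 1))"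

definition sweep_domain :: "real set \<Rightarrow> (real^2) set" where
  "sweep_domain I = {q. q $ 1 \<in> I}"

text \<open>The normalization to arc length turns $H = \langle N, X\rangle$ for the swept surface
  into an ordinary differential equation for the generating curve, and gives a meaning to
  maximality of the interval. Smoothness of the curve is part of that of the surface.\<close>

definition generating_solution ::
    "translation_type \<Rightarrow> soliton_type \<Rightarrow> real set \<Rightarrow> (real \<Rightarrow> real^2) \<Rightarrow> bool" where
  "generating_solution G \<delta> I c \<longleftrightarrow>
     open I \<and> is_interval I \<and> I \<noteq> {} \<and> c ` I \<subseteq> profile_domain G \<and>
     (\<forall>s\<in>I. metric_inner (generating_curve G c s)
        (vector_derivative (generating_curve G c) (at s))
        (vector_derivative (generating_curve G c) (at s)) = 1) \<and>
     soliton (soliton_field \<delta>) (sweep_domain I) (sweep G c)"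

definition grim_reaper ::
    "translation_type \<Rightarrow> soliton_type \<Rightarrow> real set \<Rightarrow> (real \<Rightarrow> real^2) \<Rightarrow> bool" where
  "grim_reaper G \<delta> I c \<longleftrightarrow> generating_solution G \<delta> I c \<and>
     (\<forall>J d. generating_solution G \<delta> J d \<and> I \<subseteq> J \<and> (\<forall>s\<in>I. d s = c s) \<longrightarrow> J = I)"

end

theory Submission imports Defs
begin

text \<open>
  Each translation group acts freely, so the surface is embedded as soon as its generating curve
  is: when the parameter of the curve depends continuously on the point, the inverse of the
  immersion is continuous on the whole image. It remains to study fifteen plane curves.

  In all fifteen cases there are coordinates \<open>(a, b)\<close> on the orbit space in which the equation
  \<open>H = \<langle>N, X\<rangle>\<close> is invariant under translations of \<open>a\<close>. If \<open>(C, S)\<close> is the unit tangent, the curve solves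
    \<open>a' = p(b) C, b' = q(b) S, C' = - S \<kappa>, S' = C \<kappa>, \<kappa> = A(b) C + B(b) S\<close>
  with \<open>p, q > 0\<close> (locale \<open>profile_curve\<close>). Such a curve does not meet itself or
  accumulate on itself, for one of three reasons collected in \<open>profile_embedded\<close>.

  \<^item> If \<open>B = 0\<close> along the curve, then \<open>C\<close> solves a linear equation, so it vanishes
    identically or nowhere: \<open>b\<close> or \<open>a\<close> is strictly monotone.

  \<^item> Otherwise \<open>A\<close> changes sign at most once, from negative to positive. If \<open>S\<close> has no
    zero, \<open>b\<close> is strictly monotone. A zero of \<open>S\<close> where \<open>A < 0\<close> is a strict maximum of \<open>b\<close>, and after it \<open>b\<close> stays where \<open>A < 0\<close>, so that no minimum, hence no further zero, can follow.
    The curve consists of an increasing and a decreasing branch, both graphs of \<open>a\<close> over \<open>b\<close>. Compare the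
    branches at equal height: if \<open>\<sigma>\<close> is the parameter on the first branch that matches \<open>s\<close> on the second,
    the sine \<open>P = S(\<sigma>) C(s) - C(\<sigma>) S(s)\<close> of the angle between the two tangents solves a linear equation,
    because the contribution of \<open>B\<close> cancels. Hence \<open>P\<close> keeps its sign, and the horizontal gap
    \<open>a(s) - a(\<sigma>)\<close>, whose derivative is \<open>p P / S(\<sigma>)\<close>, moves steadily away from 0 below
    the maximum (\<open>branches_diverge\<close>). Minima are maxima of the reflected curve.

  \<^item> A zero of \<open>S\<close> where \<open>A = 0\<close> forces \<open>b\<close> to be constant, and then \<open>a\<close> is strictly monotone.

  The coordinates are \<open>(x, y)\<close> for the vertical group, except that for the field of the homotheties polar
  coordinates \<open>(ln r, x / y)\<close> are needed; \<open>(z, y)\<close> for the parabolic group; and \<open>(z, x / y)\<close> for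
  the hyperbolic group. Under hyperbolic translations the fields \<open>\<partial>\<^sub>x\<close> and \<open>\<plusminus> \<partial>\<^sub>y\<close> are rescaled, which
  forces their normal component to vanish, so these cases lead to the equation with \<open>B = 0\<close> too.
\<close>

section \<open>Linear differential inequalities\<close>

text \<open>On the segment between the two points \<open>k\<close> is bounded by some \<open>K\<close>, so \<open>F e\<^sup>-\<^sup>K\<^sup>t\<close> decreases and
  \<open>F e\<^sup>K\<^sup>t\<close> increases: a zero of \<open>F\<close> propagates both forwards and backwards.\<close>

lemma gronwall_zero:
  fixes F F' k :: "real \<Rightarrow> real"
  assumes J: "is_interval J" and s0: "s0 \<in> J" and s: "s \<in> J" and F0: "F s0 = 0"
    and der: "\<And>t. t \<in> J \<Longrightarrow> (F has_real_derivative F' t) (at t)"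
    and nonneg: "\<And>t. t \<in> J \<Longrightarrow> 0 \<le> F t"
    and bound: "\<And>t. t \<in> J \<Longrightarrow> \<bar>F' t\<bar> \<le> k t * F t"
    and k: "continuous_on J k"
  shows "F s = 0"
proof -
  have sub: "{min s0 s..max s0 s} \<subseteq> J"
    using mem_is_interval_1_I[OF J s0 s] mem_is_interval_1_I[OF J s s0]
    by (cases "s0 \<le> s") auto
  have "bounded (k ` {min s0 s..max s0 s})"
    by (intro compact_imp_bounded compact_continuous_image continuous_on_subset[OF k sub]) simp
  then obtain K where K: "\<And>t. t \<in> {min s0 s..max s0 s} \<Longrightarrow> \<bar>k t\<bar> \<le> K"
    unfolding bounded_iff real_norm_def ball_simps by blast
  have K2: "\<bar>F' t\<bar> \<le> K * F t" if "t \<in> {min s0 s..max s0 s}" for t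
  proof -
    have "t \<in> J" using that sub by blast
    then show ?thesis
      using order_trans[OF bound[of t] mult_right_mono[OF order_trans[OF abs_ge_self K[OF that]] nonneg[of t]]]
      by blast
  qed
  show ?thesis
  proof (cases "s0 \<le> s")
    case True
    have "F s * exp (- K * s) \<le> F s0 * exp (- K * s0)"
    proof (rule DERIV_nonpos_imp_nonincreasing[OF True])
      fix t assume t: "s0 \<le> t" "t \<le> s"
      then have tJ: "t \<in> {min s0 s..max s0 s}" by auto
      have "((\<lambda>t. F t * exp (- K * t)) has_real_derivative (F' t - K * F t) * exp (- K * t)) (at t)"
        by (rule derivative_eq_intros der subsetD[OF sub tJ] refl)+ (simp add: algebra_simps)
      moreover have "(F' t - K * F t) * exp (- K * t) \<le> 0"
        using K2[OF tJ] by (intro mult_nonpos_nonneg) auto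
      ultimately show "\<exists>y. ((\<lambda>t. F t * exp (- K * t)) has_real_derivative y) (at t) \<and> y \<le> 0" by blast
    qed
    then show ?thesis using nonneg[OF s] F0 by (auto simp: mult_le_0_iff)
  next
    case False
    then have le: "s \<le> s0" by simp
    have "F s * exp (K * s) \<le> F s0 * exp (K * s0)"
    proof (rule DERIV_nonneg_imp_nondecreasing[OF le])
      fix t assume t: "s \<le> t" "t \<le> s0"
      then have tJ: "t \<in> {min s0 s..max s0 s}" by auto
      have "((\<lambda>t. F t * exp (K * t)) has_real_derivative (F' t + K * F t) * exp (K * t)) (at t)"
        by (rule derivative_eq_intros der subsetD[OF sub tJ] refl)+ (simp add: algebra_simps)
      moreover have "(F' t + K * F t) * exp (K * t) \<ge> 0"
        using K2[OF tJ] by (intro mult_nonneg_nonneg) auto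
      ultimately show "\<exists>y. ((\<lambda>t. F t * exp (K * t)) has_real_derivative y) (at t) \<and> 0 \<le> y" by blast
    qed
    then show ?thesis using nonneg[OF s] F0 by (auto simp: mult_le_0_iff)
  qed
qed

lemma linear_ode_zero:
  fixes f k :: "real \<Rightarrow> real"
  assumes "is_interval J" "s0 \<in> J" "s \<in> J" "f s0 = 0"
    and der: "\<And>t. t \<in> J \<Longrightarrow> (f has_real_derivative k t * f t) (at t)"
    and k: "continuous_on J k"
  shows "f s = 0"
proof -
  have "(f s)\<^sup>2 = 0"
  proof (rule gronwall_zero[OF assms(1-3), where F' = "\<lambda>t. 2 * f t * (k t * f t)" and k = "\<lambda>t. 2 * \<bar>k t\<bar>"])
    show "((\<lambda>t. (f t)\<^sup>2) has_real_derivative 2 * f t * (k t * f t)) (at t)" if "t \<in> J" for t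
      using that by (auto intro!: derivative_eq_intros der)
    show "\<bar>2 * f t * (k t * f t)\<bar> \<le> 2 * \<bar>k t\<bar> * (f t)\<^sup>2" for t
      by (simp add: abs_mult power2_eq_square mult_ac)
    show "continuous_on J (\<lambda>t. 2 * \<bar>k t\<bar>)" by (intro continuous_intros k)
  qed (use assms(4) in auto)
  then show ?thesis by simp
qed

lemma inj_on_if_derivative_nonzero:
  fixes f f' :: "real \<Rightarrow> real"
  assumes "is_interval I" and der: "\<And>t. t \<in> I \<Longrightarrow> (f has_real_derivative f' t) (at t)"
    and nz: "\<And>t. t \<in> I \<Longrightarrow> f' t \<noteq> 0"
  shows "inj_on f I"
proof (rule linorder_inj_onI)
  fix x y assume xy: "x < y" "x \<in> I" "y \<in> I"
  then have sub: "{x..y} \<subseteq> I" using mem_is_interval_1_I[OF assms(1) xy(2,3)] by auto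
  show "f x \<noteq> f y"
  proof
    assume eq: "f x = f y"
    have "\<exists>z. x < z \<and> z < y \<and> f y - f x = (y - x) * f' z"
      using sub xy by (intro MVT2 der) auto
    then obtain z where "x < z" "z < y" "f' z = 0" using eq xy by auto
    then show False using nz[of z] subsetD[OF sub, of z] by auto
  qed
qed auto

section \<open>Plane curves with a translation-invariant equation\<close>

text \<open>\<open>(C, S)\<close> is the unit tangent in an orthogonal, not necessarily orthonormal, coordinate frame with scale
  factors \<open>1 / p\<close> and \<open>1 / q\<close>, and \<open>A C + B S\<close> is its rotation speed. All coefficients depend
  on \<open>b\<close> only; this is the invariance under translations of \<open>a\<close>. Working with \<open>(C, S)\<close> instead of an
  angle avoids the choice of a lift.\<close>

locale profile_curve =
  fixes I :: "real set" and p q A B a b C S :: "real \<Rightarrow> real"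
  assumes open_I: "open I" and interval: "is_interval I"
    and p_pos: "s \<in> I \<Longrightarrow> 0 < p (b s)" and q_pos: "s \<in> I \<Longrightarrow> 0 < q (b s)"
    and q_cont: "continuous_on I (\<lambda>s. q (b s))"
    and A_cont: "continuous_on I (\<lambda>s. A (b s))"
    and B_cont: "continuous_on I (\<lambda>s. B (b s))"
    and a_deriv: "s \<in> I \<Longrightarrow> (a has_real_derivative p (b s) * C s) (at s)"
    and b_deriv: "s \<in> I \<Longrightarrow> (b has_real_derivative q (b s) * S s) (at s)"
    and C_deriv: "s \<in> I \<Longrightarrow> (C has_real_derivative - S s * (A (b s) * C s + B (b s) * S s)) (at s)"
    and S_deriv: "s \<in> I \<Longrightarrow> (S has_real_derivative C s * (A (b s) * C s + B (b s) * S s)) (at s)"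
    and unit: "s \<in> I \<Longrightarrow> (C s)\<^sup>2 + (S s)\<^sup>2 = 1"
begin

lemma cont: "continuous_on I a" "continuous_on I b" "continuous_on I C" "continuous_on I S"
  by (auto intro!: continuous_at_imp_continuous_on
      DERIV_isCont[OF a_deriv] DERIV_isCont[OF b_deriv] DERIV_isCont[OF C_deriv] DERIV_isCont[OF S_deriv])

lemma segment: "x \<in> I \<Longrightarrow> y \<in> I \<Longrightarrow> x \<le> t \<Longrightarrow> t \<le> y \<Longrightarrow> t \<in> I"
  using mem_is_interval_1_I[OF interval] .

text \<open>The next two symmetries reduce every two-branch argument to the left branch below a maximum.\<close>

lemma reversed: "profile_curve (uminus ` I) p q A B (\<lambda>s. a (- s)) (\<lambda>s. b (- s)) (\<lambda>s. - C (- s)) (\<lambda>s. - S (- s))"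
proof
  show "open (uminus ` I)" using open_I by (rule open_negations)
  show "is_interval (uminus ` I)" using interval by simp
  have minus: "continuous_on (uminus ` I) (\<lambda>s. f (- s))" if "continuous_on I f" for f :: "real \<Rightarrow> real"
    by (rule continuous_on_compose2[OF that]) (auto intro!: continuous_intros)
  show "continuous_on (uminus ` I) (\<lambda>s. q (b (- s)))" "continuous_on (uminus ` I) (\<lambda>s. A (b (- s)))"
    "continuous_on (uminus ` I) (\<lambda>s. B (b (- s)))"
    using minus[OF q_cont] minus[OF A_cont] minus[OF B_cont] by auto
  have chain: "((\<lambda>s. f (- s)) has_real_derivative - D) (at s)" if "(f has_real_derivative D) (at (- s))"
    for f :: "real \<Rightarrow> real" and D s
    using DERIV_chain2[OF that DERIV_minus[OF DERIV_ident]] by simp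
  fix s assume "s \<in> uminus ` I"
  then have s: "- s \<in> I" by auto
  show "0 < p (b (- s))" "0 < q (b (- s))" "(- C (- s))\<^sup>2 + (- S (- s))\<^sup>2 = 1"
    using p_pos q_pos unit s by auto
  show "((\<lambda>s. a (- s)) has_real_derivative p (b (- s)) * - C (- s)) (at s)"
    "((\<lambda>s. b (- s)) has_real_derivative q (b (- s)) * - S (- s)) (at s)"
    using chain[OF a_deriv[OF s]] chain[OF b_deriv[OF s]] by simp_all
  show "((\<lambda>s. - C (- s)) has_real_derivative - (- S (- s)) * (A (b (- s)) * - C (- s) + B (b (- s)) * - S (- s))) (at s)"
    using DERIV_minus[OF chain[OF C_deriv[OF s]]] by (simp add: algebra_simps)
  show "((\<lambda>s. - S (- s)) has_real_derivative - C (- s) * (A (b (- s)) * - C (- s) + B (b (- s)) * - S (- s))) (at s)"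
    using DERIV_minus[OF chain[OF S_deriv[OF s]]] by (simp add: algebra_simps)
qed

lemma flipped: "profile_curve I (\<lambda>\<beta>. p (- \<beta>)) (\<lambda>\<beta>. q (- \<beta>)) (\<lambda>\<beta>. - A (- \<beta>)) (\<lambda>\<beta>. B (- \<beta>))
    a (\<lambda>s. - b s) C (\<lambda>s. - S s)"
proof
  fix s assume s: "s \<in> I"
  show "((\<lambda>s. - b s) has_real_derivative q (- (- b s)) * - S s) (at s)"
    using DERIV_minus[OF b_deriv[OF s]] by simp
  show "(C has_real_derivative - (- S s) * (- A (- (- b s)) * C s + B (- (- b s)) * - S s)) (at s)"
    using C_deriv[OF s] by (simp add: algebra_simps)
  show "((\<lambda>s. - S s) has_real_derivative C s * (- A (- (- b s)) * C s + B (- (- b s)) * - S s)) (at s)"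
    using DERIV_minus[OF S_deriv[OF s]] by (simp add: algebra_simps)
qed (use open_I interval p_pos q_pos q_cont A_cont[THEN continuous_on_minus] B_cont a_deriv unit in simp_all)

text \<open>The sign of \<open>A\<close> decides the type of a critical point of \<open>b\<close>: at a zero of \<open>S\<close> one has \<open>S' = C\<^sup>2 A = A\<close>.
  After a maximum \<open>b\<close> falls, so \<open>A\<close> stays negative; at the next zero \<open>S\<close> would have to reach 0 from below with a
  negative derivative.\<close>

lemma S_negative_after_maximum:
  assumes sign: "\<And>x y. A x < 0 \<Longrightarrow> y \<le> x \<Longrightarrow> A y < 0"
    and s0: "s0 \<in> I" "S s0 = 0" "A (b s0) < 0" and s: "s \<in> I" "s0 < s"
  shows "S s < 0"
proof (rule ccontr)
  assume "\<not> S s < 0"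
  have dec: "\<exists>l<0. (S has_real_derivative l) (at t)" if "t \<in> I" "S t = 0" "A (b t) < 0" for t
  proof -
    have "(C t)\<^sup>2 = 1" using unit[OF that(1)] that by simp
    then have "C t * (A (b t) * C t + B (b t) * S t) = A (b t)"
      using that by (simp add: power2_eq_square algebra_simps)
    then have "C t * (A (b t) * C t + B (b t) * S t) < 0" using that by linarith
    then show ?thesis using S_deriv[OF that(1)] by blast
  qed
  obtain d where d: "0 < d" "\<And>h. 0 < h \<Longrightarrow> h < d \<Longrightarrow> S (s0 + h) < 0"
    using dec[OF s0] DERIV_neg_dec_right s0(2) by metis
  define r where "r = s0 + min d (s - s0) / 2"
  have r: "s0 < r" "r \<le> s" "\<And>t. s0 < t \<Longrightarrow> t \<le> r \<Longrightarrow> S t < 0"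
  proof -
    show "s0 < r" "r \<le> s" using d s by (auto simp: r_def min_def field_simps)
    fix t assume "s0 < t" "t \<le> r"
    then show "S t < 0" using d(2)[of "t - s0"] d(1) s by (auto simp: r_def min_def field_simps split: if_splits)
  qed
  have sub: "{r..s} \<subseteq> I" using segment[OF s0(1) s(1)] r by auto
  \<comment> \<open>the first parameter at which \<open>S\<close> is no longer negative will be the minimum of this compact set\<close>
  define Z where "Z = {t \<in> {r..s}. S t \<in> {0..}}"
  have "closed ({r..s} \<inter> S -` {0..})"
    by (intro continuous_closed_preimage continuous_on_subset[OF cont(4) sub]) auto
  then have "closed Z" by (simp add: Z_def vimage_def Int_def)
  moreover have "bounded Z" by (rule bounded_subset[of "{r..s}"]) (auto simp: Z_def)
  moreover have "s \<in> Z" using \<open>\<not> S s < 0\<close> r by (auto simp: Z_def)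
  ultimately obtain z where z: "z \<in> Z" "\<And>t. t \<in> Z \<Longrightarrow> z \<le> t"
    by (metis compact_attains_inf compact_eq_bounded_closed empty_iff)
  have zI: "z \<in> I" "S z \<ge> 0" "r \<le> z" "z \<le> s" using z(1) sub by (auto simp: Z_def)
  have "r \<noteq> z" using r(3)[of r] r(1) zI by auto
  then have rz: "r < z" using zI by simp
  have neg: "S t < 0" if "s0 < t" "t < z" for t
    using that r(3)[of t] z(2)[of t] zI by (force simp: Z_def not_less)
  have "b z < b s0"
  proof (rule DERIV_neg_imp_decreasing_open[of s0 z])
    show "s0 < z" using r rz by simp
    show "\<exists>y. (b has_real_derivative y) (at x) \<and> y < 0" if "s0 < x" "x < z" for x
    proof -
      have "x \<in> I" using that segment[OF s0(1) zI(1)] by auto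
      then show ?thesis using b_deriv[of x] q_pos[of x] neg[OF that] by (meson mult_pos_neg)
    qed
    show "continuous_on {s0..z} b"
      by (rule continuous_on_subset[OF cont(2)]) (use segment[OF s0(1) zI(1)] in auto)
  qed
  then have Az: "A (b z) < 0" using sign[OF s0(3)] by simp
  \<comment> \<open>whether \<open>S z\<close> is zero or positive, \<open>S\<close> is positive just before \<open>z\<close>, against the choice of \<open>z\<close>\<close>
  have "\<exists>d>0. \<forall>h. 0 < h \<longrightarrow> h < d \<longrightarrow> S (z - h) > 0"
  proof (cases "S z = 0")
    case True
    then show ?thesis using dec[OF zI(1) True Az] DERIV_neg_dec_left by metis
  next
    case False
    then have pos: "S z > 0" using zI by simp
    have "isCont S z" using S_deriv[OF zI(1)] by (rule DERIV_isCont)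
    then have "\<forall>\<^sub>F t in at z. S t > 0" using pos by (simp add: isCont_def order_tendstoD(1))
    then obtain d where d: "0 < d" "\<And>t. t \<noteq> z \<Longrightarrow> dist t z < d \<Longrightarrow> S t > 0"
      unfolding eventually_at by blast
    have "S (z - h) > 0" if "0 < h" "h < d" for h
      using d(2)[of "z - h"] that by (simp add: dist_real_def)
    then show ?thesis using d(1) by blast
  qed
  then obtain e where e: "0 < e" "\<And>h. 0 < h \<Longrightarrow> h < e \<Longrightarrow> S (z - h) > 0" by blast
  define h where "h = min e (z - r) / 2"
  have "0 < h" "h < e" "h < z - r" using e(1) rz by (auto simp: h_def min_def)
  then have "S (z - h) > 0" "r < z - h" "z - h < z" using e(2) by auto
  then show False using neg[of "z - h"] r(1) by simp
qed

lemma S_positive_before_maximum: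
  assumes sign: "\<And>x y. A x < 0 \<Longrightarrow> y \<le> x \<Longrightarrow> A y < 0"
    and s0: "s0 \<in> I" "S s0 = 0" "A (b s0) < 0" and s: "s \<in> I" "s < s0"
  shows "0 < S s"
  using profile_curve.S_negative_after_maximum[OF reversed, of "- s0" "- s"] assms by auto

lemma increasing_where_S_positive:
  assumes "x \<in> I" "y \<in> I" "x < y" "\<And>t. x < t \<Longrightarrow> t < y \<Longrightarrow> 0 < S t"
  shows "b x < b y"
proof (rule DERIV_pos_imp_increasing_open[OF assms(3)])
  show "\<exists>D. (b has_real_derivative D) (at t) \<and> 0 < D" if "x < t" "t < y" for t
  proof -
    have "t \<in> I" using segment[OF assms(1,2)] that by simp
    then show ?thesis using b_deriv q_pos assms(4)[OF that] by (meson mult_pos_pos)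
  qed
  show "continuous_on {x..y} b"
    by (rule continuous_on_subset[OF cont(2)]) (use segment[OF assms(1,2)] in auto)
qed

lemma decreasing_where_S_negative:
  assumes "x \<in> I" "y \<in> I" "x < y" "\<And>t. x < t \<Longrightarrow> t < y \<Longrightarrow> S t < 0"
  shows "b y < b x"
  using profile_curve.increasing_where_S_positive[OF reversed, of "- y" "- x"] assms
  by (simp add: minus_less_iff)

text \<open>The two branches below a maximum, compared at equal heights. The linear equation for \<open>P\<close> rests on two
  facts: coefficients at equal heights agree, and in the derivative of the angle between the tangents the terms with
  \<open>B\<close> cancel, since both tangents turn by \<open>B / q\<close> per unit of height. The factor \<open>C m = \<plusminus>1\<close> records the direction in
  which the maximum is traversed. The choice \<open>l' = r' = m\<close> shows that the branches are disjoint, the general case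
  that their gap grows downwards.\<close>

lemma branches_diverge:
  assumes m: "m \<in> I" "S m = 0"
    and pos: "\<And>s. s \<in> I \<Longrightarrow> s < m \<Longrightarrow> 0 < S s" and neg: "\<And>s. s \<in> I \<Longrightarrow> m < s \<Longrightarrow> S s < 0"
    and I: "l \<in> I" "r \<in> I" and ord: "l \<le> l'" "l' \<le> m" "m \<le> r'" "r' < r"
    and heights: "b l = b r" "b l' = b r'"
  shows "C m * (a r' - a l') < C m * (a r - a l)"
proof -
  have mr: "m < r" using ord by simp
  have sub_l: "{l..m} \<subseteq> I" and sub_r: "{m..r} \<subseteq> I"
    using segment[OF I(1) m(1)] segment[OF m(1) I(2)] by auto
  have inc: "b x < b y" if "x \<in> {l..m}" "y \<in> {l..m}" "x < y" for x y
    using that by (intro increasing_where_S_positive pos subsetD[OF sub_l]) auto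
  have dec: "b y < b x" if "x \<in> {m..r}" "y \<in> {m..r}" "x < y" for x y
    using that by (intro decreasing_where_S_negative neg subsetD[OF sub_r]) auto
  have br: "b r < b m" using dec[of m r] mr by simp
  then have lm: "l < m" using heights ord by (cases "l = m") auto
  have "inj_on b {l..m}"
    by (rule linorder_inj_onI) (use inc in force)+
  then obtain g where g: "homeomorphism {l..m} (b ` {l..m}) b g"
    using injective_into_1d_eq_homeomorphism[of "{l..m}" b] continuous_on_subset[OF cont(2) sub_l]
    by (auto simp: is_interval_path_connected_1[symmetric] is_interval_cc)
  have image: "b ` {l..m} = {b l..b m}"
  proof
    show "b ` {l..m} \<subseteq> {b l..b m}"
    proof
      fix y assume "y \<in> b ` {l..m}"
      then obtain x where x: "x \<in> {l..m}" "y = b x" by blast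
      show "y \<in> {b l..b m}" using inc[of l x] inc[of x m] x by (cases "x = l"; cases "x = m") auto
    qed
    show "{b l..b m} \<subseteq> b ` {l..m}"
      using IVT'[of b l _ m] lm continuous_on_subset[OF cont(2) sub_l] by force
  qed
  \<comment> \<open>the parameter on the left branch at the height of \<open>s\<close>\<close>
  define \<sigma> where "\<sigma> = (\<lambda>s. g (b s))"
  have b_right: "b s \<in> {b l..b m}" if "s \<in> {m..r}" for s
    using dec[of m s] dec[of s r] that heights by (cases "s = m"; cases "s = r") auto
  have \<sigma>: "\<sigma> s \<in> {l..m}" "b (\<sigma> s) = b s" if "s \<in> {m..r}" for s
    using g b_right[OF that] unfolding image[symmetric] \<sigma>_def homeomorphism_def by auto
  have \<sigma>_cont: "continuous_on {m..r} \<sigma>"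
    unfolding \<sigma>_def
    by (rule continuous_on_compose2[OF homeomorphism_cont2[OF g] continuous_on_subset[OF cont(2) sub_r]])
      (use b_right image in auto)
  have \<sigma>_eq: "\<sigma> s = t" if "t \<in> {l..m}" "b t = b s" for s t
    using g that unfolding \<sigma>_def homeomorphism_def by metis
  have \<sigma>_open: "l < \<sigma> s" "\<sigma> s < m" if s: "s \<in> {m<..<r}" for s
  proof -
    have "b r < b s" "b s < b m" using s mr by (auto intro!: dec)
    then have "\<sigma> s \<noteq> l" "\<sigma> s \<noteq> m" using \<sigma>(2)[of s] s heights by auto
    then show "l < \<sigma> s" "\<sigma> s < m" using \<sigma>(1)[of s] s by auto
  qed
  have S\<sigma>: "0 < S (\<sigma> s)" if "s \<in> {m<..<r}" for s
    using \<sigma>_open[OF that] by (intro pos subsetD[OF sub_l]) auto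
  have \<sigma>I: "\<sigma> s \<in> I" "s \<in> I" if "s \<in> {m..r}" for s
    using \<sigma>(1)[OF that] sub_l sub_r that by auto
  have \<sigma>_deriv: "(\<sigma> has_real_derivative S s / S (\<sigma> s)) (at s)" if s: "s \<in> {m<..<r}" for s
  proof -
    have bs: "b l < b s" "b s < b m" using dec[of s r] dec[of m s] s mr heights by auto
    have s': "s \<in> {m..r}" using s by auto
    have "(g has_real_derivative inverse (q (b s) * S (\<sigma> s))) (at (b s))"
    proof (rule DERIV_inverse_function[where a = "b l" and b = "b m"])
      show "(b has_real_derivative q (b s) * S (\<sigma> s)) (at (g (b s)))"
        using b_deriv[OF \<sigma>I(1)[OF s']] \<sigma>(2)[OF s'] by (simp add: \<sigma>_def)
      show "q (b s) * S (\<sigma> s) \<noteq> 0" using q_pos[OF \<sigma>I(2)[OF s']] S\<sigma>[OF s] by simp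
      show "b (g y) = y" if "b l < y" "y < b m" for y
        using g that unfolding image homeomorphism_def by auto
      have "continuous_on {b l<..<b m} g"
        by (rule continuous_on_subset[OF homeomorphism_cont2[OF g]]) (auto simp: image)
      then show "isCont g (b s)" using bs by (simp add: continuous_on_eq_continuous_at)
    qed (use bs in auto)
    from DERIV_chain2[OF this b_deriv[OF \<sigma>I(2)[OF s']]]
    show ?thesis using q_pos[OF \<sigma>I(2)[OF s']] by (simp add: \<sigma>_def field_simps)
  qed
  have comp_cont: "continuous_on {m..r} (\<lambda>s. f (\<sigma> s))" if "continuous_on I f" for f :: "real \<Rightarrow> real"
    by (rule continuous_on_compose2[OF that \<sigma>_cont]) (use \<sigma>I in auto)
  have comp_deriv: "((\<lambda>s. f (\<sigma> s)) has_real_derivative D * (S s / S (\<sigma> s))) (at s)"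
    if "(f has_real_derivative D) (at (\<sigma> s))" "s \<in> {m<..<r}" for f :: "real \<Rightarrow> real" and D s
    using DERIV_chain2[OF that(1) \<sigma>_deriv[OF that(2)]] .
  \<comment> \<open>the sine of the angle from the tangent at \<open>s\<close> to the tangent at \<open>\<sigma> s\<close>\<close>
  define P where "P s = S (\<sigma> s) * C s - C (\<sigma> s) * S s" for s
  define k where "k s = - A (b s) * (C s * C (\<sigma> s) + S s * S (\<sigma> s)) / S (\<sigma> s)" for s
  have P_deriv: "(P has_real_derivative k s * P s) (at s)" if s: "s \<in> {m<..<r}" for s
  proof -
    have s': "s \<in> {m..r}" using s by auto
    note [simp] = \<sigma>(2)[OF s']
    define \<kappa> \<kappa>\<sigma> where "\<kappa> = A (b s) * C s + B (b s) * S s"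
      and "\<kappa>\<sigma> = A (b s) * C (\<sigma> s) + B (b s) * S (\<sigma> s)"
    have S': "(S has_real_derivative C s * \<kappa>) (at s)" and C': "(C has_real_derivative - S s * \<kappa>) (at s)"
      using S_deriv[OF \<sigma>I(2)[OF s']] C_deriv[OF \<sigma>I(2)[OF s']] by (simp_all add: \<kappa>_def)
    have S\<sigma>': "((\<lambda>s. S (\<sigma> s)) has_real_derivative C (\<sigma> s) * \<kappa>\<sigma> * (S s / S (\<sigma> s))) (at s)"
      and C\<sigma>': "((\<lambda>s. C (\<sigma> s)) has_real_derivative - S (\<sigma> s) * \<kappa>\<sigma> * (S s / S (\<sigma> s))) (at s)"
      using comp_deriv[OF S_deriv[OF \<sigma>I(1)[OF s']] s] comp_deriv[OF C_deriv[OF \<sigma>I(1)[OF s']] s]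
      by (simp_all add: \<kappa>\<sigma>_def)
    have "(P has_real_derivative (C s * C (\<sigma> s) + S s * S (\<sigma> s)) * (\<kappa>\<sigma> * (S s / S (\<sigma> s)) - \<kappa>)) (at s)"
      unfolding P_def by (rule derivative_eq_intros S' C' S\<sigma>' C\<sigma>' refl)+ (simp add: algebra_simps)
    moreover have "\<kappa>\<sigma> * (S s / S (\<sigma> s)) - \<kappa> = - A (b s) * P s / S (\<sigma> s)"
      using S\<sigma>[OF s] by (simp add: \<kappa>_def \<kappa>\<sigma>_def P_def field_simps)
    ultimately show ?thesis by (simp add: k_def mult_ac)
  qed
  have k_cont: "continuous_on {m<..<r} k"
  proof -
    have sub: "{m<..<r} \<subseteq> {m..r}" by auto
    note on = continuous_on_subset[OF _ sub] continuous_on_subset[OF _ order_trans[OF sub sub_r]]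
    show ?thesis
      unfolding k_def
      by (intro continuous_intros on(2)[OF A_cont] on(2)[OF cont(3)] on(2)[OF cont(4)]
          on(1)[OF comp_cont[OF cont(3)]] on(1)[OF comp_cont[OF cont(4)]])
        (use S\<sigma> in force)
  qed
  have Cm: "C m * C m = 1" using unit[OF m(1)] m(2) by (simp add: power2_eq_square)
  \<comment> \<open>near the maximum both tangents are close to \<open>(C m, 0)\<close>, and the signs of \<open>S\<close> decide\<close>
  obtain d where d: "0 < d" "\<And>s. s \<in> {m<..<r} \<Longrightarrow> s < m + d \<Longrightarrow> 0 < C m * P s"
  proof -
    have \<sigma>m: "\<sigma> m = m" by (rule \<sigma>_eq) (use lm in auto)
    have "continuous_on {m..r} (\<lambda>s. C m * C s)" "continuous_on {m..r} (\<lambda>s. C m * C (\<sigma> s))"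
      by (intro continuous_intros continuous_on_subset[OF cont(3) sub_r] comp_cont[OF cont(3)])+
    moreover have "m \<in> {m..r}" using mr by simp
    ultimately have "((\<lambda>s. C m * C s) \<longlongrightarrow> 1) (at m within {m..r})"
      "((\<lambda>s. C m * C (\<sigma> s)) \<longlongrightarrow> 1) (at m within {m..r})"
      unfolding continuous_on_def using Cm \<sigma>m by metis+
    then have "\<forall>\<^sub>F s in at m within {m..r}. 0 < C m * C s" "\<forall>\<^sub>F s in at m within {m..r}. 0 < C m * C (\<sigma> s)"
      by (auto intro: order_tendstoD(1)[of _ 1])
    then have "\<forall>\<^sub>F s in at m within {m..r}. 0 < C m * C s \<and> 0 < C m * C (\<sigma> s)"
      by eventually_elim simp
    then obtain d where "0 < d" and d: "\<And>s. s \<in> {m..r} \<Longrightarrow> s \<noteq> m \<Longrightarrow> dist s m < d \<Longrightarrow>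
        0 < C m * C s \<and> 0 < C m * C (\<sigma> s)"
      unfolding eventually_at by blast
    show thesis
    proof (rule that[OF \<open>0 < d\<close>])
      fix s assume s: "s \<in> {m<..<r}" "s < m + d"
      then have "0 < C m * C s" "0 < C m * C (\<sigma> s)" using d[of s] by (auto simp: dist_real_def)
      moreover have "0 < S (\<sigma> s)" "S s < 0" using S\<sigma>[OF s(1)] neg[of s] subsetD[OF sub_r, of s] s by auto
      ultimately have "0 < S (\<sigma> s) * (C m * C s)" "(C m * C (\<sigma> s)) * S s < 0"
        by (simp_all add: mult_pos_pos mult_pos_neg del: mult_less_0_iff zero_less_mult_iff)
      then show "0 < C m * P s" by (simp add: P_def algebra_simps)
    qed
  qed
  have P_pos: "0 < C m * P s" if s: "s \<in> {m<..<r}" for s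
  proof -
    define t where "t = min (m + d / 2) ((m + s) / 2)"
    have t: "t \<in> {m<..<r}" "t < m + d" "t \<le> s" using s d(1) by (auto simp: t_def min_def)
    then have Pt: "0 < C m * P t" using d(2) by blast
    have nonzero: "P u \<noteq> 0" if "u \<in> {m<..<r}" for u
    proof
      assume "P u = 0"
      then have "P t = 0"
        by (intro linear_ode_zero[of "{m<..<r}" u t P k] P_deriv k_cont that t(1)) (auto simp: is_interval_oo)
      then show False using Pt by simp
    qed
    show ?thesis
    proof (rule ccontr)
      assume "\<not> 0 < C m * P s"
      moreover have "continuous_on {t..s} (\<lambda>u. C m * P u)"
        using s t by (intro continuous_intros continuous_at_imp_continuous_on ballI DERIV_isCont[OF P_deriv]) auto
      ultimately obtain u where "t \<le> u" "u \<le> s" "C m * P u = 0"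
        using IVT2'[of "\<lambda>u. C m * P u" s 0 t] Pt t(3) by auto
      then show False using nonzero[of u] s t Cm by auto
    qed
  qed
  have "C m * (a r' - a (\<sigma> r')) < C m * (a r - a (\<sigma> r))"
  proof (rule DERIV_pos_imp_increasing_open[OF ord(4), where f = "\<lambda>s. C m * (a s - a (\<sigma> s))"])
    fix s assume "r' < s" "s < r"
    then have s: "s \<in> {m<..<r}" using ord by auto
    then have s': "s \<in> {m..r}" by auto
    have "((\<lambda>s. C m * (a s - a (\<sigma> s))) has_real_derivative
        C m * (p (b s) * C s - p (b s) * C (\<sigma> s) * (S s / S (\<sigma> s)))) (at s)"
      using comp_deriv[OF a_deriv[OF \<sigma>I(1)[OF s']] s] \<sigma>(2)[OF s']
      by (intro DERIV_cmult DERIV_diff a_deriv \<sigma>I(2)[OF s']) simp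
    moreover have "C m * (p (b s) * C s - p (b s) * C (\<sigma> s) * (S s / S (\<sigma> s)))
        = p (b s) * (C m * P s) / S (\<sigma> s)"
      using S\<sigma>[OF s] by (simp add: P_def field_simps)
    moreover have "0 < p (b s) * (C m * P s) / S (\<sigma> s)"
      using p_pos[OF \<sigma>I(2)[OF s']] P_pos[OF s] S\<sigma>[OF s] by simp
    ultimately show "\<exists>D. ((\<lambda>s. C m * (a s - a (\<sigma> s))) has_real_derivative D) (at s) \<and> 0 < D"
      by metis
  next
    have "{r'..r} \<subseteq> {m..r}" using ord by auto
    then show "continuous_on {r'..r} (\<lambda>s. C m * (a s - a (\<sigma> s)))"
      using continuous_on_subset[OF comp_cont[OF cont(1)]] continuous_on_subset[OF cont(1)] sub_r
      by (intro continuous_intros) blast+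
  qed
  moreover have "\<sigma> r = l" by (rule \<sigma>_eq) (use heights lm in auto)
  moreover have "\<sigma> r' = l'" by (rule \<sigma>_eq) (use heights ord in auto)
  ultimately show ?thesis by simp
qed

text \<open>A point of the left branch has a neighbourhood that the right branch avoids. At any height below \<open>b (s + \<eta>)\<close> the
  gap between the branches exceeds its value \<open>e\<close> at that height, whereas \<open>a\<close> varies by less than \<open>e / 2\<close> on
  the left branch near \<open>s\<close>. This also excludes that the end of the right branch accumulates at the point.\<close>

lemma parameter_near_left_point:
  assumes m: "m \<in> I" "S m = 0"
    and pos: "\<And>s. s \<in> I \<Longrightarrow> s < m \<Longrightarrow> 0 < S s" and neg: "\<And>s. s \<in> I \<Longrightarrow> m < s \<Longrightarrow> S s < 0"
    and s: "s \<in> I" "s < m" and \<epsilon>: "0 < \<epsilon>"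
  shows "\<exists>\<delta>>0. \<forall>t\<in>I. \<bar>a t - a s\<bar> < \<delta> \<longrightarrow> \<bar>b t - b s\<bar> < \<delta> \<longrightarrow> \<bar>t - s\<bar> < \<epsilon>"
proof -
  have inc: "b x < b y" if "x \<in> I" "y \<in> I" "x < y" "y \<le> m" for x y
    using that by (intro increasing_where_S_positive pos segment[OF that(1,2)]) auto
  have dec: "b y < b x" if "x \<in> I" "y \<in> I" "x < y" "m \<le> x" for x y
    using that by (intro decreasing_where_S_negative neg segment[OF that(1,2)]) auto
  obtain \<rho> where \<rho>: "0 < \<rho>" "\<And>t. \<bar>t - s\<bar> < \<rho> \<Longrightarrow> t \<in> I"
    using open_I s(1) unfolding open_dist dist_real_def by blast
  define \<eta> where "\<eta> = min (\<rho> / 2) (min \<epsilon> ((m - s) / 2))"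
  have \<eta>: "0 < \<eta>" "\<eta> \<le> \<epsilon>" "s + \<eta> < m" "\<eta> < \<rho>"
    using \<rho>(1) \<epsilon> s(2) by (auto simp: \<eta>_def min_def field_simps)
  have uI: "s + \<eta> \<in> I" using \<rho>(2)[of "s + \<eta>"] \<eta> by simp
  \<comment> \<open>if the right branch does not reach down to the height \<open>b (s + \<eta>)\<close>, the condition on \<open>e\<close> is empty\<close>
  obtain e where e: "0 < e"
    "\<And>l t. t \<in> I \<Longrightarrow> m \<le> t \<Longrightarrow> l \<in> I \<Longrightarrow> l \<le> m \<Longrightarrow> b l = b t \<Longrightarrow> b t < b (s + \<eta>) \<Longrightarrow> e < C m * (a t - a l)"
  proof (cases "\<exists>v\<in>I. m \<le> v \<and> b v = b (s + \<eta>)")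
    case True
    then obtain v where v: "v \<in> I" "m \<le> v" "b v = b (s + \<eta>)" by blast
    have "b (s + \<eta>) < b m" using inc[OF uI m(1)] \<eta> by simp
    then have mv: "m < v" using v by (cases "m = v") auto
    show thesis
    proof (rule that)
      show "0 < C m * (a v - a (s + \<eta>))"
        using branches_diverge[OF m pos neg uI v(1), of m m] \<eta> mv v(3) by simp
      fix l t assume t: "t \<in> I" "m \<le> t" "l \<in> I" "l \<le> m" "b l = b t" "b t < b (s + \<eta>)"
      have "l \<le> s + \<eta>" using inc[OF uI t(3)] t by (cases "s + \<eta> < l") auto
      moreover have "v < t" using dec[OF t(1) v(1)] t v(3) by (cases "t < v"; cases "t = v") auto
      ultimately show "C m * (a v - a (s + \<eta>)) < C m * (a t - a l)"
        using branches_diverge[OF m pos neg t(3,1), of "s + \<eta>" v] \<eta> mv v(3) t(5) by simp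
    qed
  next
    case False
    have no: "\<not> b t < b (s + \<eta>)" if t: "t \<in> I" "m \<le> t" for t
    proof
      assume "b t < b (s + \<eta>)"
      moreover have "b (s + \<eta>) < b m" using inc[OF uI m(1)] \<eta> by simp
      moreover have "continuous_on {m..t} b"
        by (rule continuous_on_subset[OF cont(2)]) (use segment[OF m(1) t(1)] in auto)
      ultimately obtain v where "m \<le> v" "v \<le> t" "b v = b (s + \<eta>)"
        using IVT2'[of b t "b (s + \<eta>)" m] t by auto
      then show False using False segment[OF m(1) t(1), of v] by blast
    qed
    show thesis by (rule that[of 1]) (use no in auto)
  qed
  have "isCont a s" using a_deriv[OF s(1)] by (rule DERIV_isCont)
  then obtain \<tau> where \<tau>: "0 < \<tau>" "\<And>t. \<bar>t - s\<bar> < \<tau> \<Longrightarrow> \<bar>a t - a s\<bar> < e / 2"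
    using half_gt_zero[OF e(1)] unfolding continuous_at_eps_delta dist_real_def by metis
  define \<theta> where "\<theta> = min \<eta> \<tau>"
  have \<theta>: "0 < \<theta>" "\<theta> \<le> \<eta>" "\<theta> \<le> \<tau>" using \<eta> \<tau> by (auto simp: \<theta>_def)
  have ends: "s - \<theta> \<in> I" "s + \<theta> \<in> I" "s + \<theta> < m" using \<rho>(2)[of "s - \<theta>"] \<rho>(2)[of "s + \<theta>"] \<theta> \<eta> by auto
  define \<delta> where "\<delta> = min (e / 2) (min (b (s + \<theta>) - b s) (b s - b (s - \<theta>)))"
  have "0 < \<delta>"
    using e(1) inc[OF s(1) ends(2)] inc[OF ends(1) s(1)] \<theta>(1) ends(3) s(2) by (simp add: \<delta>_def)
  moreover have "\<bar>t - s\<bar> < \<epsilon>" if t: "t \<in> I" "\<bar>a t - a s\<bar> < \<delta>" "\<bar>b t - b s\<bar> < \<delta>" for t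
  proof -
    have bt: "b (s - \<theta>) < b t" "b t < b (s + \<theta>)" using t(3) by (auto simp: \<delta>_def)
    show ?thesis
    proof (cases "t < m")
      case True
      have "s - \<theta> < t" using inc[OF t(1) ends(1)] bt ends \<theta> s by (cases "t < s - \<theta>"; cases "t = s - \<theta>") auto
      moreover have "t < s + \<theta>" using inc[OF ends(2) t(1)] bt True by (cases "s + \<theta> < t"; cases "t = s + \<theta>") auto
      ultimately show ?thesis using \<theta> \<eta> by auto
    next
      case False
      have "continuous_on {s - \<theta>..s + \<theta>} b"
        by (rule continuous_on_subset[OF cont(2)]) (use segment[OF ends(1,2)] in auto)
      then obtain l where l: "s - \<theta> \<le> l" "l \<le> s + \<theta>" "b l = b t"
        using IVT'[of b "s - \<theta>" "b t" "s + \<theta>"] bt \<theta>(1) by auto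
      then have ne: "l \<noteq> s - \<theta>" "l \<noteq> s + \<theta>" using bt by auto
      have lI: "l \<in> I" using segment[OF ends(1,2)] l by auto
      have "b (s + \<theta>) \<le> b (s + \<eta>)" using inc[OF ends(2) uI] \<theta> \<eta> by (cases "\<theta> = \<eta>") auto
      then have "e < C m * (a t - a l)" using e(2)[of t l] t(1) lI l False ends(3) bt by auto
      also have "\<dots> \<le> \<bar>C m * (a t - a l)\<bar>" by (rule abs_ge_self)
      also have "\<dots> = \<bar>a t - a l\<bar>"
        using unit[OF m(1)] m(2) by (simp add: abs_mult power2_eq_1_iff) (auto)
      also have "\<dots> \<le> \<bar>a t - a s\<bar> + \<bar>a l - a s\<bar>" by simp
      also have "\<dots> < e"
      proof -
        have "\<bar>l - s\<bar> < \<tau>" using l ne \<theta>(3) by linarith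
        moreover have "\<bar>a t - a s\<bar> < e / 2" using t(2) by (simp add: \<delta>_def)
        ultimately show ?thesis using \<tau>(2)[of l] by linarith
      qed
      finally show ?thesis .
    qed
  qed
  ultimately show ?thesis by blast
qed

lemma parameter_near_point:
  assumes m: "m \<in> I" "S m = 0"
    and pos: "\<And>s. s \<in> I \<Longrightarrow> s < m \<Longrightarrow> 0 < S s" and neg: "\<And>s. s \<in> I \<Longrightarrow> m < s \<Longrightarrow> S s < 0"
    and s: "s \<in> I" and \<epsilon>: "0 < \<epsilon>"
  shows "\<exists>\<delta>>0. \<forall>t\<in>I. \<bar>a t - a s\<bar> < \<delta> \<longrightarrow> \<bar>b t - b s\<bar> < \<delta> \<longrightarrow> \<bar>t - s\<bar> < \<epsilon>"
proof -
  consider "s < m" | "m < s" | "s = m" by linarith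
  then show ?thesis
  proof cases
    case 1
    then show ?thesis using parameter_near_left_point[OF m pos neg s] \<epsilon> by blast
  next
    case 2
    have "\<exists>\<delta>>0. \<forall>t\<in>uminus ` I. \<bar>a (- t) - a (- (- s))\<bar> < \<delta> \<longrightarrow> \<bar>b (- t) - b (- (- s))\<bar> < \<delta> \<longrightarrow> \<bar>t - (- s)\<bar> < \<epsilon>"
      by (rule profile_curve.parameter_near_left_point[OF reversed, of "- m"])
        (use m pos neg s \<epsilon> 2 in auto)
    then obtain \<delta> where \<delta>: "0 < \<delta>" "\<And>t. t \<in> uminus ` I \<Longrightarrow> \<bar>a (- t) - a (- (- s))\<bar> < \<delta> \<Longrightarrow>
        \<bar>b (- t) - b (- (- s))\<bar> < \<delta> \<Longrightarrow> \<bar>t - (- s)\<bar> < \<epsilon>"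
      by blast
    have "\<bar>t - s\<bar> < \<epsilon>" if "t \<in> I" "\<bar>a t - a s\<bar> < \<delta>" "\<bar>b t - b s\<bar> < \<delta>" for t
      using \<delta>(2)[of "- t"] that by simp
    then show ?thesis using \<delta>(1) by blast
  next
    case 3
    obtain \<rho> where \<rho>: "0 < \<rho>" "\<And>t. \<bar>t - m\<bar> < \<rho> \<Longrightarrow> t \<in> I"
      using open_I m(1) unfolding open_dist dist_real_def by blast
    define \<eta> where "\<eta> = min (\<rho> / 2) \<epsilon>"
    have \<eta>: "0 < \<eta>" "\<eta> \<le> \<epsilon>" "\<eta> < \<rho>" using \<rho>(1) \<epsilon> by (auto simp: \<eta>_def min_def)
    have ends: "m - \<eta> \<in> I" "m + \<eta> \<in> I" using \<rho>(2)[of "m - \<eta>"] \<rho>(2)[of "m + \<eta>"] \<eta> by auto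
    have inc: "b x < b y" if "x \<in> I" "y \<in> I" "x < y" "y \<le> m" for x y
      using that by (intro increasing_where_S_positive pos segment[OF that(1,2)]) auto
    have dec: "b y < b x" if "x \<in> I" "y \<in> I" "x < y" "m \<le> x" for x y
      using that by (intro decreasing_where_S_negative neg segment[OF that(1,2)]) auto
    define \<delta> where "\<delta> = min (b m - b (m - \<eta>)) (b m - b (m + \<eta>))"
    have "0 < \<delta>" using inc[OF ends(1) m(1)] dec[OF m(1) ends(2)] \<eta>(1) by (simp add: \<delta>_def)
    moreover have "\<bar>t - m\<bar> < \<epsilon>" if t: "t \<in> I" "\<bar>b t - b m\<bar> < \<delta>" for t
    proof (rule ccontr)
      assume far: "\<not> \<bar>t - m\<bar> < \<epsilon>"
      have "b t \<le> b (m - \<eta>) \<or> b t \<le> b (m + \<eta>)"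
      proof (cases "t \<le> m")
        case True
        then show ?thesis using far \<eta> inc[OF t(1) ends(1)] by (cases "t = m - \<eta>") auto
      next
        case False
        then show ?thesis using far \<eta> dec[OF ends(2) t(1)] by (cases "t = m + \<eta>") auto
      qed
      then show False using t(2) by (auto simp: \<delta>_def)
    qed
    ultimately show ?thesis using 3 by blast
  qed
qed

end

text \<open>Injectivity and continuity of the inverse are the same estimate: apply it with \<open>\<epsilon> = \<bar>t - s\<bar>\<close> to a double point.\<close>

lemma continuous_inverse_if_parameters_close:
  fixes k :: "real \<Rightarrow> real \<times> real"
  assumes close: "\<And>s \<epsilon>. s \<in> I \<Longrightarrow> 0 < \<epsilon> \<Longrightarrow>
    \<exists>\<delta>>0. \<forall>t\<in>I. \<bar>fst (k t) - fst (k s)\<bar> < \<delta> \<longrightarrow> \<bar>snd (k t) - snd (k s)\<bar> < \<delta> \<longrightarrow> \<bar>t - s\<bar> < \<epsilon>"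
  shows "\<exists>g. continuous_on (k ` I) g \<and> (\<forall>s\<in>I. g (k s) = s)"
proof (intro exI conjI ballI)
  have "inj_on k I"
  proof (rule inj_onI, rule ccontr)
    fix t s assume "t \<in> I" "s \<in> I" "k t = k s" "t \<noteq> s"
    then show False using close[of s "\<bar>t - s\<bar>"] by auto
  qed
  then show g: "inv_into I k (k s) = s" if "s \<in> I" for s
    using that by (rule inv_into_f_f)
  show "continuous_on (k ` I) (inv_into I k)"
    unfolding continuous_on_iff
  proof (intro ballI allI impI)
    fix x \<epsilon> assume "x \<in> k ` I" "(0::real) < \<epsilon>"
    then obtain s where s: "s \<in> I" "x = k s" by blast
    obtain \<delta> where \<delta>: "0 < \<delta>" "\<And>t. t \<in> I \<Longrightarrow> \<bar>fst (k t) - fst (k s)\<bar> < \<delta> \<Longrightarrow>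
        \<bar>snd (k t) - snd (k s)\<bar> < \<delta> \<Longrightarrow> \<bar>t - s\<bar> < \<epsilon>"
      using close[OF s(1) \<open>0 < \<epsilon>\<close>] by blast
    have "dist (inv_into I k y) (inv_into I k x) < \<epsilon>" if y: "y \<in> k ` I" "dist y x < \<delta>" for y
    proof -
      obtain t where t: "t \<in> I" "y = k t" using y(1) by blast
      have "\<bar>fst (k t) - fst (k s)\<bar> < \<delta>" "\<bar>snd (k t) - snd (k s)\<bar> < \<delta>"
        using y(2) dist_fst_le[of y x] dist_snd_le[of y x] s t by (simp_all add: dist_real_def)
      then show ?thesis using \<delta>(2)[OF t(1)] g s t by (simp add: dist_real_def)
    qed
    then show "\<exists>\<delta>>0. \<forall>y\<in>k ` I. dist y x < \<delta> \<longrightarrow> dist (inv_into I k y) (inv_into I k x) < \<epsilon>"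
      using \<delta>(1) by blast
  qed
qed

lemma continuous_inverse_if_coordinate_inj:
  fixes f :: "real \<Rightarrow> real"
  assumes "is_interval I" "continuous_on I f" "inj_on f I" "continuous_on (k ` I) h"
    and "\<And>s. s \<in> I \<Longrightarrow> h (k s) = f s"
  shows "\<exists>g. continuous_on (k ` I) g \<and> (\<forall>s\<in>I. g (k s) = s)"
proof -
  obtain g where g: "homeomorphism I (f ` I) f g"
    using injective_into_1d_eq_homeomorphism[of I f] assms by (auto simp: is_interval_path_connected_1)
  have "continuous_on (k ` I) (\<lambda>x. g (h x))"
    by (rule continuous_on_compose2[OF homeomorphism_cont2[OF g] assms(4)]) (use assms(5) in auto)
  moreover have "\<forall>s\<in>I. g (h (k s)) = s" using assms(5) homeomorphism_apply1[OF g] by simp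
  ultimately show ?thesis by blast
qed

context profile_curve
begin

lemma embedded_if_maximum:
  assumes sign: "\<And>x y. A x < 0 \<Longrightarrow> y \<le> x \<Longrightarrow> A y < 0"
    and m: "m \<in> I" "S m = 0" "A (b m) < 0"
  shows "\<exists>g. continuous_on ((\<lambda>s. (a s, b s)) ` I) g \<and> (\<forall>s\<in>I. g (a s, b s) = s)"
proof (rule continuous_inverse_if_parameters_close)
  fix s \<epsilon> assume "s \<in> I" "(0::real) < \<epsilon>"
  then show "\<exists>\<delta>>0. \<forall>t\<in>I. \<bar>fst (a t, b t) - fst (a s, b s)\<bar> < \<delta> \<longrightarrow> \<bar>snd (a t, b t) - snd (a s, b s)\<bar> < \<delta> \<longrightarrow>
      \<bar>t - s\<bar> < \<epsilon>"
    using parameter_near_point[OF m(1,2) S_positive_before_maximum[OF sign m]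
        S_negative_after_maximum[OF sign m]] by simp
qed

lemma embedded_if_a_inj:
  assumes "inj_on a I"
  shows "\<exists>g. continuous_on ((\<lambda>s. (a s, b s)) ` I) g \<and> (\<forall>s\<in>I. g (a s, b s) = s)"
  by (rule continuous_inverse_if_coordinate_inj[OF interval cont(1) assms, of _ fst])
    (rule continuous_on_fst[OF continuous_on_id], simp)

lemma embedded_if_b_inj:
  assumes "inj_on b I"
  shows "\<exists>g. continuous_on ((\<lambda>s. (a s, b s)) ` I) g \<and> (\<forall>s\<in>I. g (a s, b s) = s)"
  by (rule continuous_inverse_if_coordinate_inj[OF interval cont(2) assms, of _ snd])
    (rule continuous_on_snd[OF continuous_on_id], simp)

lemma a_inj:
  assumes "\<And>s. s \<in> I \<Longrightarrow> C s \<noteq> 0"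
  shows "inj_on a I"
  by (rule inj_on_if_derivative_nonzero[OF interval a_deriv]) (use assms p_pos in force)+

lemma b_inj:
  assumes "\<And>s. s \<in> I \<Longrightarrow> S s \<noteq> 0"
  shows "inj_on b I"
  by (rule inj_on_if_derivative_nonzero[OF interval b_deriv]) (use assms q_pos in force)+

text \<open>A curve of constant height \<open>b m\<close> solves the equation through such a point, so this is uniqueness of solutions. As
  \<open>A\<close> vanishes at \<open>b m\<close> and is bounded by the distance to it, the squared distance to the constant solution satisfies
  a linear differential inequality.\<close>

lemma S_zero_if_stationary:
  assumes A: "\<And>x y. A x = 0 \<Longrightarrow> \<bar>A y\<bar> \<le> \<bar>y - x\<bar>"
    and m: "m \<in> I" "S m = 0" "A (b m) = 0" and s: "s \<in> I"
  shows "S s = 0"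
proof -
  define F where "F t = (b t - b m)\<^sup>2 + (S t)\<^sup>2" for t
  define D where "D t = 2 * (b t - b m) * (q (b t) * S t) + 2 * S t * (C t * (A (b t) * C t + B (b t) * S t))" for t
  have "F s = 0"
  proof (rule gronwall_zero[OF interval m(1) s, of F D "\<lambda>t. q (b t) + 1 + 2 * \<bar>B (b t)\<bar>"])
    show "F m = 0" using m by (simp add: F_def)
    fix t assume t: "t \<in> I"
    show "(F has_real_derivative D t) (at t)"
      unfolding F_def D_def by (rule derivative_eq_intros b_deriv S_deriv t refl)+ (simp add: algebra_simps)
    show "0 \<le> F t" by (simp add: F_def)
    have CS2: "(C t)\<^sup>2 \<le> 1" using unit[OF t] zero_le_power2[of "S t"] by linarith
    then have CS1: "\<bar>C t\<bar> \<le> 1" by (simp add: abs_square_le_1)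
    have xy: "2 * \<bar>b t - b m\<bar> * \<bar>S t\<bar> \<le> F t"
      using sum_squares_bound[of "\<bar>b t - b m\<bar>" "\<bar>S t\<bar>"] by (simp add: F_def)
    have "\<bar>2 * (b t - b m) * (q (b t) * S t)\<bar> = q (b t) * (2 * \<bar>b t - b m\<bar> * \<bar>S t\<bar>)"
      using q_pos[OF t] by (simp add: abs_mult del: right_diff_distrib_numeral)
    also have "\<dots> \<le> q (b t) * F t" using xy q_pos[OF t] by (simp add: mult_left_mono)
    finally have 1: "\<bar>2 * (b t - b m) * (q (b t) * S t)\<bar> \<le> q (b t) * F t" .
    have "\<bar>2 * S t * A (b t) * (C t)\<^sup>2\<bar> = 2 * \<bar>S t\<bar> * \<bar>A (b t)\<bar> * (C t)\<^sup>2" by (simp add: abs_mult)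
    also have "\<dots> \<le> 2 * \<bar>S t\<bar> * \<bar>A (b t)\<bar>" using CS2 by (intro mult_right_le_one_le) auto
    also have "\<dots> \<le> 2 * \<bar>S t\<bar> * \<bar>b t - b m\<bar>" using A[OF m(3)] by (intro mult_left_mono) auto
    also have "\<dots> \<le> F t" using xy by (simp add: mult_ac)
    finally have 2: "\<bar>2 * S t * A (b t) * (C t)\<^sup>2\<bar> \<le> F t" .
    have "\<bar>2 * B (b t) * C t * (S t)\<^sup>2\<bar> = 2 * \<bar>B (b t)\<bar> * (S t)\<^sup>2 * \<bar>C t\<bar>" by (simp add: abs_mult)
    also have "\<dots> \<le> 2 * \<bar>B (b t)\<bar> * (S t)\<^sup>2" using CS1 by (intro mult_right_le_one_le) auto
    also have "\<dots> \<le> 2 * \<bar>B (b t)\<bar> * F t" by (intro mult_left_mono) (auto simp: F_def)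
    finally have 3: "\<bar>2 * B (b t) * C t * (S t)\<^sup>2\<bar> \<le> 2 * \<bar>B (b t)\<bar> * F t" .
    have "D t = 2 * (b t - b m) * (q (b t) * S t) + 2 * S t * A (b t) * (C t)\<^sup>2 + 2 * B (b t) * C t * (S t)\<^sup>2"
      by (simp add: D_def power2_eq_square algebra_simps)
    then have "\<bar>D t\<bar> \<le> q (b t) * F t + F t + 2 * \<bar>B (b t)\<bar> * F t" using 1 2 3 by linarith
    then show "\<bar>D t\<bar> \<le> (q (b t) + 1 + 2 * \<bar>B (b t)\<bar>) * F t" by (simp add: algebra_simps)
  qed (intro continuous_intros q_cont B_cont)
  then show ?thesis by (simp add: F_def sum_power2_eq_zero_iff)
qed

text \<open>For \<open>B = 0\<close> the equation \<open>C' = - S A C\<close> is linear in \<open>C\<close>.\<close>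

lemma C_nonzero_or_S_nonzero:
  assumes "\<And>s. s \<in> I \<Longrightarrow> B (b s) = 0"
  shows "(\<forall>s\<in>I. C s \<noteq> 0) \<or> (\<forall>s\<in>I. S s \<noteq> 0)"
proof (rule ccontr)
  assume "\<not> ?thesis"
  then obtain s t where s: "s \<in> I" "C s = 0" and t: "t \<in> I" "S t = 0" by blast
  have "C t = 0"
  proof (rule linear_ode_zero[OF interval s(1) t(1), of C "\<lambda>u. - S u * A (b u)"])
    show "(C has_real_derivative - S u * A (b u) * C u) (at u)" if "u \<in> I" for u
      using C_deriv[OF that] assms[OF that] by (simp add: mult_ac)
  qed (use s in \<open>intro continuous_intros cont A_cont | simp\<close>)+
  then show False using unit[OF t(1)] t by simp
qed

theorem profile_embedded:
  assumes "(\<forall>s\<in>I. B (b s) = 0) \<or>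
    (\<forall>x y. A x < 0 \<longrightarrow> y \<le> x \<longrightarrow> A y < 0) \<and> (\<forall>x y. 0 < A x \<longrightarrow> x \<le> y \<longrightarrow> 0 < A y) \<and>
    (\<forall>x y. A x = 0 \<longrightarrow> \<bar>A y\<bar> \<le> \<bar>y - x\<bar>)"
  shows "\<exists>g. continuous_on ((\<lambda>s. (a s, b s)) ` I) g \<and> (\<forall>s\<in>I. g (a s, b s) = s)"
  using assms
proof (elim disjE conjE)
  assume "\<forall>s\<in>I. B (b s) = 0"
  then show ?thesis
    using C_nonzero_or_S_nonzero a_inj b_inj embedded_if_a_inj embedded_if_b_inj by blast
next
  assume neg: "\<forall>x y. A x < 0 \<longrightarrow> y \<le> x \<longrightarrow> A y < 0" and pos: "\<forall>x y. 0 < A x \<longrightarrow> x \<le> y \<longrightarrow> 0 < A y"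
    and lip: "\<forall>x y. A x = 0 \<longrightarrow> \<bar>A y\<bar> \<le> \<bar>y - x\<bar>"
  show ?thesis
  proof (cases "\<exists>m\<in>I. S m = 0")
    case False
    then show ?thesis using b_inj embedded_if_b_inj by blast
  next
    case True
    then obtain m where m: "m \<in> I" "S m = 0" by blast
    consider "A (b m) < 0" | "A (b m) = 0" | "0 < A (b m)" by linarith
    then show ?thesis
    proof cases
      case 1
      then show ?thesis using embedded_if_maximum neg m by blast
    next
      case 2
      then have "S s = 0" if "s \<in> I" for s using S_zero_if_stationary[OF _ m] lip that by blast
      then have "C s \<noteq> 0" if "s \<in> I" for s using unit[OF that] that by auto
      then show ?thesis using a_inj embedded_if_a_inj by blast
    next
      case 3
      \<comment> \<open>a minimum of \<open>b\<close> is a maximum of the flipped curve\<close>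
      have "\<exists>g. continuous_on ((\<lambda>s. (a s, - b s)) ` I) g \<and> (\<forall>s\<in>I. g (a s, - b s) = s)"
      proof (rule profile_curve.embedded_if_maximum[OF flipped, of m])
        show "- A (- y) < 0" if "- A (- x) < 0" "y \<le> x" for x y
          using pos[rule_format, of "- x" "- y"] that by simp
      qed (use m 3 in auto)
      then obtain g where g: "continuous_on ((\<lambda>s. (a s, - b s)) ` I) g" "\<And>s. s \<in> I \<Longrightarrow> g (a s, - b s) = s"
        by blast
      have "continuous_on ((\<lambda>s. (a s, b s)) ` I) (\<lambda>x. g (fst x, - snd x))"
        by (rule continuous_on_compose2[OF g(1)]) (auto intro!: continuous_intros)
      then show ?thesis using g(2) by (intro exI[of _ "\<lambda>x. g (fst x, - snd x)"]) simp
    qed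
  qed
qed

end

section \<open>The geometry of the ambient space in coordinates\<close>

lemma metric_inner_eq:
  "metric_inner p v w = (v $ 1 * w $ 1 + v $ 2 * w $ 2) / (p $ 2)\<^sup>2 + v $ 3 * w $ 3"
  unfolding metric_inner_def HR_metric_def by (simp add: sum_3) (simp add: add_divide_distrib)

lemma partial_deriv_eqI:
  assumes "((\<lambda>h. f (p + h *\<^sub>R axis i 1)) has_vector_derivative D) (at 0)"
  shows "partial_deriv i f p = D"
  using assms unfolding partial_deriv_def by (rule vector_derivative_at)

lemma partial_deriv_HR_metric:
  assumes "p \<in> HR"
  shows "partial_deriv i (\<lambda>q. HR_metric q $ j $ l) p =
    (if i = 2 \<and> j = l \<and> j \<noteq> 3 then - 2 / (p $ 2) ^ 3 else 0)"
proof (rule partial_deriv_eqI)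
  have p: "p $ 2 > 0" using assms by (simp add: HR_def)
  show "((\<lambda>h. HR_metric (p + h *\<^sub>R axis i 1) $ j $ l) has_vector_derivative
      (if i = 2 \<and> j = l \<and> j \<noteq> 3 then - 2 / (p $ 2) ^ 3 else 0)) (at 0)"
  proof (cases "i = 2 \<and> j = l \<and> j \<noteq> 3")
    case True
    have "((\<lambda>h. 1 / (p $ 2 + h)\<^sup>2) has_real_derivative - 2 / (p $ 2) ^ 3) (at 0)"
      using p by (auto intro!: derivative_eq_intros simp: field_simps power2_eq_square power3_eq_cube power4_eq_xxxx)
    then show ?thesis
      using True by (simp add: HR_metric_def axis_def has_real_derivative_iff_has_vector_derivative)
  next
    case False
    have "HR_metric (p + h *\<^sub>R axis i 1) $ j $ l = HR_metric p $ j $ l" for h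
    proof (cases "j = l \<and> j \<noteq> 3")
      case True
      then have "2 \<noteq> i" using False by metis
      then have "axis i (1::real) $ 2 = 0" unfolding axis_def by simp
      then show ?thesis unfolding HR_metric_def by simp
    next
      case False
      then show ?thesis unfolding HR_metric_def by (cases "j = l") simp_all
    qed
    then show ?thesis unfolding if_not_P[OF False] by simp
  qed
qed

lemma matrix_inv_diagonal:
  fixes A :: "real^'n::finite^'n"
  assumes "\<And>i j. i \<noteq> j \<Longrightarrow> A $ i $ j = 0" and "\<And>i. A $ i $ i \<noteq> 0"
  shows "matrix_inv A $ i $ j = (if i = j then 1 / A $ i $ i else 0)"
proof -
  define B where "B = (\<chi> i j. if i = j then 1 / A $ i $ i else 0)"
  have row: "A $ i $ k * B $ k $ j = (if k = i then (if i = j then 1 else 0) else 0)"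
    "B $ i $ k * A $ k $ j = (if k = i then (if i = j then 1 else 0) else 0)" for i j k
    using assms by (auto simp: B_def)
  have "A ** B = mat 1" "B ** A = mat 1"
    by (simp_all add: matrix_matrix_mult_def mat_def vec_eq_iff row)
  then have "A ** matrix_inv A = mat 1"
    unfolding matrix_inv_def using \<open>B ** A = mat 1\<close> by (metis (mono_tags, lifting) someI_ex)
  then have "matrix_inv A = B"
    using \<open>B ** A = mat 1\<close> by (metis matrix_mul_assoc matrix_mul_lid matrix_mul_rid)
  then show ?thesis by (simp add: B_def)
qed

lemma christoffel_eq:
  assumes "p \<in> HR"
  shows "christoffel p k i j =
    (if k = 1 \<and> (i = 1 \<and> j = 2 \<or> i = 2 \<and> j = 1) then - 1 / p $ 2
     else if k = 2 \<and> i = 1 \<and> j = 1 then 1 / p $ 2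
     else if k = 2 \<and> i = 2 \<and> j = 2 then - 1 / p $ 2 else 0)"
proof -
  have p: "p $ 2 > 0" using assms by (simp add: HR_def)
  have "matrix_inv (HR_metric p) $ k $ l = (if k = l then if k = 3 then 1 else (p $ 2)\<^sup>2 else 0)" for k l
    by (subst matrix_inv_diagonal) (use p in \<open>auto simp: HR_metric_def\<close>)
  moreover have "i = 1 \<or> i = 2 \<or> i = 3" "j = 1 \<or> j = 2 \<or> j = 3" "k = 1 \<or> k = 2 \<or> k = 3"
    using exhaust_3 by auto
  ultimately show ?thesis
    using p unfolding christoffel_def partial_deriv_HR_metric[OF assms]
    by (elim disjE) (simp_all add: sum_3 field_simps power2_eq_square power3_eq_cube)
qed

text \<open>The only nonzero Christoffel symbols are \<open>\<Gamma>\<^sup>1\<^sub>1\<^sub>2 = \<Gamma>\<^sup>1\<^sub>2\<^sub>1 = \<Gamma>\<^sup>2\<^sub>2\<^sub>2 = - 1 / y\<close> and \<open>\<Gamma>\<^sup>2\<^sub>1\<^sub>1 = 1 / y\<close>.\<close>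

lemma cov_deriv_eq:
  fixes \<Psi> :: "real^2 \<Rightarrow> real^3"
  assumes "\<Psi> q \<in> HR"
  shows "cov_deriv \<Psi> a b q $ 1 = partial_deriv a (partial_deriv b \<Psi>) q $ 1
      - (partial_deriv a \<Psi> q $ 1 * partial_deriv b \<Psi> q $ 2
         + partial_deriv a \<Psi> q $ 2 * partial_deriv b \<Psi> q $ 1) / \<Psi> q $ 2"
    and "cov_deriv \<Psi> a b q $ 2 = partial_deriv a (partial_deriv b \<Psi>) q $ 2
      + (partial_deriv a \<Psi> q $ 1 * partial_deriv b \<Psi> q $ 1
         - partial_deriv a \<Psi> q $ 2 * partial_deriv b \<Psi> q $ 2) / \<Psi> q $ 2"
    and "cov_deriv \<Psi> a b q $ 3 = partial_deriv a (partial_deriv b \<Psi>) q $ 3"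
  by (simp_all add: cov_deriv_def christoffel_eq[OF assms] sum_3 add_divide_distrib diff_divide_distrib)

lemma mean_curvature_orthonormal:
  assumes "first_fundamental \<Psi> q $ 1 $ 1 = 1" "first_fundamental \<Psi> q $ 1 $ 2 = 0"
    "first_fundamental \<Psi> q $ 2 $ 1 = 0" "first_fundamental \<Psi> q $ 2 $ 2 \<noteq> 0"
  shows "mean_curvature \<Psi> N q = (metric_inner (\<Psi> q) (N q) (cov_deriv \<Psi> 1 1 q)
    + metric_inner (\<Psi> q) (N q) (cov_deriv \<Psi> 2 2 q) / first_fundamental \<Psi> q $ 2 $ 2) / 2"
proof -
  have "matrix_inv (first_fundamental \<Psi> q) $ i $ j =
      (if i = j then 1 / first_fundamental \<Psi> q $ i $ i else 0)" for i j
  proof (rule matrix_inv_diagonal)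
    show "first_fundamental \<Psi> q $ i $ j = 0" if "i \<noteq> j" for i j
      using that assms exhaust_2[of i] exhaust_2[of j] by auto
    show "first_fundamental \<Psi> q $ i $ i \<noteq> 0" for i
      using assms exhaust_2[of i] by auto
  qed
  then show ?thesis
    by (simp add: mean_curvature_def trace_def matrix_matrix_mult_def sum_2 second_fundamental_def assms)
qed

section \<open>Surfaces swept out by a one-parameter group\<close>

definition scale :: "translation_type \<Rightarrow> real \<Rightarrow> real" where
  "scale G t = (if G = Hyperbolic then exp t else 1)"

definition stretch :: "real \<Rightarrow> real^3 \<Rightarrow> real^3" where
  "stretch k v = vector [k * v $ 1, k * v $ 2, v $ 3]"

lemma stretch_nth [simp]: "stretch k v $ 1 = k * v $ 1" "stretch k v $ 2 = k * v $ 2" "stretch k v $ 3 = v $ 3"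
  by (simp_all add: stretch_def)

lemma stretch_1 [simp]: "stretch 1 v = v"
  by (simp add: vec_eq_iff forall_3)

lemma scale_pos [simp]: "0 < scale G t"
  by (simp add: scale_def)

lemma bounded_linear_stretch: "bounded_linear (stretch k)"
  by (rule linear_conv_bounded_linear[THEN iffD1], rule linearI)
    (simp_all add: vec_eq_iff forall_3 algebra_simps)

text \<open>Translations are affine maps; their linear parts carry the velocity of the generating curve along the orbits.\<close>

lemma translation_eq_stretch:
  "translation G t p = stretch (scale G t) p + translation G t 0"
  by (cases G) (simp_all add: vec_eq_iff forall_3 scale_def)

lemma sweep_at_0: "sweep G c q = generating_curve G c (q $ 1)" if "q $ 2 = 0"
  using that by (cases G) (simp_all add: sweep_def vec_eq_iff forall_3)

lemma translation_has_derivative: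
  assumes "(\<gamma> has_vector_derivative v) (at s)"
  shows "((\<lambda>s. translation G t (\<gamma> s)) has_vector_derivative stretch (scale G t) v) (at s)"
proof -
  have "(\<lambda>s. translation G t (\<gamma> s)) = (\<lambda>s. stretch (scale G t) (\<gamma> s) + translation G t 0)"
    by (rule ext, rule translation_eq_stretch)
  then show ?thesis
    using bounded_linear.has_vector_derivative[OF bounded_linear_stretch assms]
    by (simp add: has_vector_derivative_add_const)
qed

definition killing_field :: "translation_type \<Rightarrow> real^3 \<Rightarrow> real^3" where
  "killing_field G p = (case G of Vertical \<Rightarrow> vector [0, 0, 1] | Parabolic \<Rightarrow> vector [1, 0, 0]
     | Hyperbolic \<Rightarrow> vector [p $ 1, p $ 2, 0])"

text \<open>The second coordinate derivative of an orbit, to be corrected by Christoffel symbols to obtain its geodesic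
  curvature vector.\<close>

definition killing_acceleration :: "translation_type \<Rightarrow> real^3 \<Rightarrow> real^3" where
  "killing_acceleration G p = (if G = Hyperbolic then vector [p $ 1, p $ 2, 0] else 0)"

lemma exp_line_derivative:
  fixes w e :: "real^3"
  shows "((\<lambda>h. exp (t + h) *\<^sub>R w + e) has_vector_derivative exp t *\<^sub>R w) (at 0)"
  by (auto intro!: derivative_eq_intros)

lemma translation_has_derivative_t:
  "((\<lambda>h. translation G (t + h) p) has_vector_derivative killing_field G (translation G t p)) (at 0)"
proof (cases G)
  case Vertical
  have "(\<lambda>h. translation G (t + h) p) = (\<lambda>h. h *\<^sub>R vector [0, 0, 1] + translation G t p)"
    by (auto simp: Vertical vec_eq_iff forall_3)
  then show ?thesis by (auto simp: killing_field_def Vertical intro!: derivative_eq_intros)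
next
  case Parabolic
  have "(\<lambda>h. translation G (t + h) p) = (\<lambda>h. h *\<^sub>R vector [1, 0, 0] + translation G t p)"
    by (auto simp: Parabolic vec_eq_iff forall_3)
  then show ?thesis by (auto simp: killing_field_def Parabolic intro!: derivative_eq_intros)
next
  case Hyperbolic
  have "(\<lambda>h. translation G (t + h) p) = (\<lambda>h. exp (t + h) *\<^sub>R vector [p $ 1, p $ 2, 0] + vector [0, 0, p $ 3])"
    by (auto simp: Hyperbolic vec_eq_iff forall_3)
  moreover have "killing_field G (translation G t p) = exp t *\<^sub>R vector [p $ 1, p $ 2, 0]"
    by (simp add: Hyperbolic killing_field_def vec_eq_iff forall_3)
  ultimately show ?thesis using exp_line_derivative by metis
qed

lemma killing_field_has_derivative_t:
  "((\<lambda>h. killing_field G (translation G (t + h) p)) has_vector_derivative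
    killing_acceleration G (translation G t p)) (at 0)"
proof (cases "G = Hyperbolic")
  case True
  have "(\<lambda>h. killing_field G (translation G (t + h) p)) = (\<lambda>h. exp (t + h) *\<^sub>R vector [p $ 1, p $ 2, 0] + 0)"
    by (auto simp: True killing_field_def vec_eq_iff forall_3)
  moreover have "killing_acceleration G (translation G t p) = exp t *\<^sub>R vector [p $ 1, p $ 2, 0]"
    by (simp add: True killing_acceleration_def vec_eq_iff forall_3)
  ultimately show ?thesis using exp_line_derivative by metis
next
  case False
  then show ?thesis by (cases G) (simp_all add: killing_field_def killing_acceleration_def)
qed

lemma has_vector_derivative_shift_0:
  "((\<lambda>h. f (s + h)) has_vector_derivative D) (at 0) \<longleftrightarrow> (f has_vector_derivative D) (at (s::real))"
proof
  assume "((\<lambda>h. f (s + h)) has_vector_derivative D) (at 0)"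
  then have "((\<lambda>h. f (s + h)) has_vector_derivative D) (at (s - s))" by simp
  moreover have "((\<lambda>t. t - s) has_vector_derivative 1) (at s)"
    by (auto intro!: derivative_eq_intros)
  ultimately show "(f has_vector_derivative D) (at s)"
    using vector_diff_chain_at[of "\<lambda>t. t - s" 1 s] by (fastforce simp: comp_def)
next
  assume "(f has_vector_derivative D) (at s)"
  then have "(f has_vector_derivative D) (at (s + 0))" by simp
  moreover have "((\<lambda>h. s + h) has_vector_derivative 1) (at 0)"
    by (auto intro!: derivative_eq_intros)
  ultimately show "((\<lambda>h. f (s + h)) has_vector_derivative D) (at 0)"
    using vector_diff_chain_at[of "\<lambda>h. s + h" 1 0] by (fastforce simp: comp_def)
qed

lemma axis_2_nth [simp]:
  "axis (1::2) (1::real) $ 1 = 1" "axis (1::2) (1::real) $ 2 = 0"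
  "axis (2::2) (1::real) $ 1 = 0" "axis (2::2) (1::real) $ 2 = 1"
  by (simp_all add: axis_def)

lemma eventually_shift_in_open:
  assumes "open I" "s \<in> (I :: real set)"
  shows "\<forall>\<^sub>F h in nhds 0. s + h \<in> I"
proof -
  have "isCont (\<lambda>h. s + h) 0" by (intro continuous_intros)
  then have "((\<lambda>h. s + h) \<longlongrightarrow> s) (nhds 0)" 
    using tendsto_at_iff_tendsto_nhds[of "\<lambda>h. s + h" 0] by (simp add: isCont_def)
  then show ?thesis using assms by (rule topological_tendstoD)
qed

lemma partial_1_sweep:
  assumes "(generating_curve G c has_vector_derivative v) (at (q $ 1))"
  shows "partial_deriv 1 (sweep G c) q = stretch (scale G (q $ 2)) v"
proof (rule partial_deriv_eqI)
  have "((\<lambda>h. generating_curve G c (q $ 1 + h)) has_vector_derivative v) (at 0)"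
    using assms by (rule iffD2[OF has_vector_derivative_shift_0])
  then show "((\<lambda>h. sweep G c (q + h *\<^sub>R axis 1 1)) has_vector_derivative stretch (scale G (q $ 2)) v) (at 0)"
    using translation_has_derivative by (simp add: sweep_def)
qed

lemma partial_1_1_sweep:
  assumes I: "open I" "q $ 1 \<in> I"
    and d1: "\<And>s. s \<in> I \<Longrightarrow> (generating_curve G c has_vector_derivative v s) (at s)"
    and d2: "(v has_vector_derivative w) (at (q $ 1))"
  shows "partial_deriv 1 (partial_deriv 1 (sweep G c)) q = stretch (scale G (q $ 2)) w"
proof (rule partial_deriv_eqI)
  have "((\<lambda>h. v (q $ 1 + h)) has_vector_derivative w) (at 0)"
    using d2 by (rule iffD2[OF has_vector_derivative_shift_0])
  then have "((\<lambda>h. stretch (scale G (q $ 2)) (v (q $ 1 + h))) has_vector_derivative stretch (scale G (q $ 2)) w) (at 0)"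
    by (rule bounded_linear.has_vector_derivative[OF bounded_linear_stretch])
  moreover have "\<forall>\<^sub>F h in nhds 0. partial_deriv 1 (sweep G c) (q + h *\<^sub>R axis 1 1)
      = stretch (scale G (q $ 2)) (v (q $ 1 + h))"
    using eventually_shift_in_open[OF I] by eventually_elim (simp add: partial_1_sweep[OF d1])
  ultimately show "((\<lambda>h. partial_deriv 1 (sweep G c) (q + h *\<^sub>R axis 1 1)) has_vector_derivative
      stretch (scale G (q $ 2)) w) (at 0)"
    by (subst has_vector_derivative_cong_ev) (auto elim: eventually_mono dest: eventually_nhds_x_imp_x)
qed

lemma partial_2_sweep: "partial_deriv 2 (sweep G c) q = killing_field G (sweep G c q)"
  by (rule partial_deriv_eqI) (simp add: sweep_def translation_has_derivative_t)

lemma partial_2_2_sweep: "partial_deriv 2 (partial_deriv 2 (sweep G c)) q = killing_acceleration G (sweep G c q)"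
  by (rule partial_deriv_eqI) (simp add: partial_2_sweep[abs_def] sweep_def killing_field_has_derivative_t)

lemma smooth_on_differentiable:
  assumes "smooth_on U f" "p \<in> U"
  shows "(\<lambda>h. iterated_partial is f (p + h *\<^sub>R axis i 1)) differentiable at 0"
  using assms by (simp add: smooth_on_def)

text \<open>The generating curve is the coordinate line of the surface at time 0, so smoothness of the surface provides the
  two derivatives of the curve that enter the mean curvature.\<close>

lemma generating_curve_derivatives:
  assumes smooth: "smooth_on (sweep_domain I) (sweep G c)" and I: "open I"
  obtains v w where "\<And>s. s \<in> I \<Longrightarrow> (generating_curve G c has_vector_derivative v s) (at s)"
    and "\<And>s. s \<in> I \<Longrightarrow> (v has_vector_derivative w s) (at s)"
proof -
  define q :: "real \<Rightarrow> real^2" where "q s = vector [s, 0]" for s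
  have q: "q s $ 1 = s" "q s $ 2 = 0" "s \<in> I \<Longrightarrow> q s \<in> sweep_domain I" for s
    by (simp_all add: q_def sweep_domain_def)
  define v where "v s = vector_derivative (generating_curve G c) (at s)" for s
  have v: "(generating_curve G c has_vector_derivative v s) (at s)" if "s \<in> I" for s
  proof -
    have "(\<lambda>h. iterated_partial [] (sweep G c) (q s + h *\<^sub>R axis 1 1)) differentiable at 0"
      using smooth q(3)[OF that] by (rule smooth_on_differentiable)
    then have "(\<lambda>h. generating_curve G c (s + h)) differentiable at 0"
      by (simp add: sweep_at_0 q)
    then obtain D where "((\<lambda>h. generating_curve G c (s + h)) has_vector_derivative D) (at 0)"
      using vector_derivative_works by blast
    then have "(generating_curve G c has_vector_derivative D) (at s)"
      by (rule iffD1[OF has_vector_derivative_shift_0])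
    then show ?thesis unfolding v_def using vector_derivative_at by metis
  qed
  have "\<exists>w. (v has_vector_derivative w) (at s)" if "s \<in> I" for s
  proof -
    have "(\<lambda>h. iterated_partial [1] (sweep G c) (q s + h *\<^sub>R axis 1 1)) differentiable at 0"
      using smooth q(3)[OF that] by (rule smooth_on_differentiable)
    then obtain D where D: "((\<lambda>h. partial_deriv 1 (sweep G c) (q s + h *\<^sub>R axis 1 1)) has_vector_derivative D) (at 0)"
      using vector_derivative_works by auto
    have "\<forall>\<^sub>F h in nhds 0. partial_deriv 1 (sweep G c) (q s + h *\<^sub>R axis 1 1) = v (s + h)"
      using eventually_shift_in_open[OF I that]
      by eventually_elim (simp add: partial_1_sweep[OF v] q scale_def)
    then have "((\<lambda>h. v (s + h)) has_vector_derivative D) (at 0)"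
      using D by (subst (asm) has_vector_derivative_cong_ev) (auto elim: eventually_mono dest: eventually_nhds_x_imp_x)
    then have "(v has_vector_derivative D) (at s)" by (rule iffD1[OF has_vector_derivative_shift_0])
    then show ?thesis by blast
  qed
  then obtain w where "\<And>s. s \<in> I \<Longrightarrow> (v has_vector_derivative w s) (at s)" by metis
  with v show thesis by (rule that)
qed

section \<open>The soliton equation along the generating curve\<close>

lemma component_has_derivative:
  fixes f :: "real \<Rightarrow> real^'n::finite"
  assumes "(f has_vector_derivative v) (at s)"
  shows "((\<lambda>s. f s $ i) has_real_derivative v $ i) (at s)"
  using bounded_linear.has_vector_derivative[OF bounded_linear_vec_nth assms]
  by (simp add: has_real_derivative_iff_has_vector_derivative)

lemma derivative_of_constant:
  fixes f :: "real \<Rightarrow> real"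
  assumes "open I" "s \<in> I" "\<And>t. t \<in> I \<Longrightarrow> f t = r" "(f has_real_derivative D) (at s)"
  shows "D = 0"
proof -
  have "((\<lambda>t. r) has_real_derivative D) (at s)"
    by (rule has_field_derivative_transform_within_open[OF assms(4,1,2)]) (simp add: assms(3))
  then show ?thesis using DERIV_const DERIV_unique by blast
qed

locale swept_solution =
  fixes G :: translation_type and \<delta> :: soliton_type and I :: "real set" and c :: "real \<Rightarrow> real^2"
    and \<gamma> v w :: "real \<Rightarrow> real^3"
  assumes solution: "generating_solution G \<delta> I c"
    and \<gamma>_def: "\<gamma> = generating_curve G c"
    and v: "\<And>s. s \<in> I \<Longrightarrow> (\<gamma> has_vector_derivative v s) (at s)"
    and w: "\<And>s. s \<in> I \<Longrightarrow> (v has_vector_derivative w s) (at s)"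
begin

lemma open_I: "open I" and interval: "is_interval I"
  and immersed: "immersed_surface (sweep_domain I) (sweep G c)"
  using solution by (simp_all add: generating_solution_def soliton_def)

lemma sweep_eq: "sweep G c q = stretch (scale G (q $ 2)) (\<gamma> (q $ 1)) + translation G (q $ 2) 0"
  unfolding sweep_def \<gamma>_def by (rule translation_eq_stretch)

lemma sweep_2: "sweep G c q $ 2 = scale G (q $ 2) * \<gamma> (q $ 1) $ 2"
  unfolding sweep_eq by (cases G) simp_all

lemma height_pos: "0 < \<gamma> s $ 2" if "s \<in> I"
proof -
  have "sweep G c (vector [s, 0]) \<in> HR"
    using immersed that unfolding immersed_surface_def sweep_domain_def by force
  then have "0 < scale G 0 * \<gamma> s $ 2" by (simp add: HR_def sweep_2)
  then show ?thesis by (rule zero_less_mult_pos) simp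
qed

lemma deriv: "s \<in> I \<Longrightarrow> ((\<lambda>s. \<gamma> s $ i) has_real_derivative v s $ i) (at s)"
  "s \<in> I \<Longrightarrow> ((\<lambda>s. v s $ i) has_real_derivative w s $ i) (at s)"
  using v w component_has_derivative by blast+

lemma continuous_component: "continuous_on I (\<lambda>s. \<gamma> s $ i)"
  by (intro continuous_at_imp_continuous_on ballI DERIV_isCont[OF deriv(1)])

lemma unit_speed: "((v s $ 1)\<^sup>2 + (v s $ 2)\<^sup>2) / (\<gamma> s $ 2)\<^sup>2 + (v s $ 3)\<^sup>2 = 1" if "s \<in> I"
proof -
  have "vector_derivative \<gamma> (at s) = v s" using v[OF that] by (rule vector_derivative_at)
  moreover have "metric_inner (\<gamma> s) (vector_derivative \<gamma> (at s)) (vector_derivative \<gamma> (at s)) = 1"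
    using solution that unfolding generating_solution_def \<gamma>_def by blast
  ultimately show ?thesis by (simp add: metric_inner_eq power2_eq_square)
qed

text \<open>Arc length and orthogonality make the first fundamental form diagonal with first entry 1, so that twice the mean
  curvature is the curvature of the generating curve plus that of the orbit. The equation is stated at every time:
  when the group does not preserve the field \<open>X\<close>, different times give different equations.\<close>

lemma soliton_equation:
  assumes s: "q $ 1 = s" "s \<in> I" and k: "k = scale G (q $ 2)"
    and P: "P = sweep G c q" and K: "K = killing_field G P"
    and orthogonal: "metric_inner P (stretch k (v s)) K = 0" and K0: "metric_inner P K K \<noteq> 0"
  obtains N where "metric_inner P N N = 1" "metric_inner P N (stretch k (v s)) = 0" "metric_inner P N K = 0"
    "metric_inner P N (vector [k * (w s $ 1 - 2 * v s $ 1 * v s $ 2 / \<gamma> s $ 2),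
        k * (w s $ 2 + ((v s $ 1)\<^sup>2 - (v s $ 2)\<^sup>2) / \<gamma> s $ 2), w s $ 3])
     + metric_inner P N (killing_acceleration G P
        + vector [- 2 * K $ 1 * K $ 2 / P $ 2, ((K $ 1)\<^sup>2 - (K $ 2)\<^sup>2) / P $ 2, 0]) / metric_inner P K K
     = 2 * metric_inner P N (soliton_field \<delta> P)"
proof -
  have q: "q \<in> sweep_domain I" using s by (simp add: sweep_domain_def)
  obtain N where N: "unit_normal (sweep_domain I) (sweep G c) N"
    and H: "mean_curvature (sweep G c) N q = metric_inner P (N q) (soliton_field \<delta> P)"
    using solution q unfolding generating_solution_def soliton_def P by blast
  have d1: "partial_deriv 1 (sweep G c) q = stretch k (v s)"
    unfolding k s(1)[symmetric] by (rule partial_1_sweep) (use v s \<gamma>_def in simp)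
  have d2: "partial_deriv 2 (sweep G c) q = K" unfolding K P by (rule partial_2_sweep)
  have d11: "partial_deriv 1 (partial_deriv 1 (sweep G c)) q = stretch k (w s)"
    unfolding k by (rule partial_1_1_sweep[OF open_I _ v[unfolded \<gamma>_def]]) (use s w in auto)
  have d22: "partial_deriv 2 (partial_deriv 2 (sweep G c)) q = killing_acceleration G P"
    unfolding P by (rule partial_2_2_sweep)
  have y: "0 < \<gamma> s $ 2" using height_pos s(2) .
  have k0: "0 < k" by (simp add: k)
  have P2: "P $ 2 = k * \<gamma> s $ 2" unfolding P k sweep_2 s ..
  have HR: "sweep G c q \<in> HR" unfolding P[symmetric] HR_def using P2 y k0 by simp
  have E: "metric_inner P (stretch k (v s)) (stretch k (v s)) = 1"
  proof -
    have "metric_inner P (stretch k (v s)) (stretch k (v s))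
        = ((v s $ 1)\<^sup>2 + (v s $ 2)\<^sup>2) / (\<gamma> s $ 2)\<^sup>2 + (v s $ 3)\<^sup>2"
      using y k0 by (simp add: metric_inner_eq P2 power2_eq_square field_simps)
    then show ?thesis using unit_speed[OF s(2)] by simp
  qed
  have fund: "first_fundamental (sweep G c) q $ 1 $ 1 = 1" "first_fundamental (sweep G c) q $ 1 $ 2 = 0"
    "first_fundamental (sweep G c) q $ 2 $ 1 = 0" "first_fundamental (sweep G c) q $ 2 $ 2 = metric_inner P K K"
    using E orthogonal
    by (simp_all add: first_fundamental_def d1 d2 P[symmetric]) (simp add: metric_inner_eq mult.commute)
  have c11: "cov_deriv (sweep G c) 1 1 q = vector [k * (w s $ 1 - 2 * v s $ 1 * v s $ 2 / \<gamma> s $ 2),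
        k * (w s $ 2 + ((v s $ 1)\<^sup>2 - (v s $ 2)\<^sup>2) / \<gamma> s $ 2), w s $ 3]"
    unfolding vec_eq_iff forall_3 cov_deriv_eq[where q = q and \<Psi> = "sweep G c", OF HR] d1 d11 P[symmetric] P2
    using y k0 by (simp add: field_simps power2_eq_square)
  have c22: "cov_deriv (sweep G c) 2 2 q = killing_acceleration G P
        + vector [- 2 * K $ 1 * K $ 2 / P $ 2, ((K $ 1)\<^sup>2 - (K $ 2)\<^sup>2) / P $ 2, 0]"
    unfolding vec_eq_iff forall_3 cov_deriv_eq[where q = q and \<Psi> = "sweep G c", OF HR] d2 d22 P[symmetric]
    by (simp add: power2_eq_square)
  show thesis
  proof (rule that)
    show "metric_inner P (N q) (N q) = 1" "metric_inner P (N q) (stretch k (v s)) = 0"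
      "metric_inner P (N q) K = 0"
      using N q unfolding unit_normal_def P d1[symmetric] d2[symmetric] by blast+
    show "metric_inner P (N q) (vector [k * (w s $ 1 - 2 * v s $ 1 * v s $ 2 / \<gamma> s $ 2),
        k * (w s $ 2 + ((v s $ 1)\<^sup>2 - (v s $ 2)\<^sup>2) / \<gamma> s $ 2), w s $ 3])
     + metric_inner P (N q) (killing_acceleration G P
        + vector [- 2 * K $ 1 * K $ 2 / P $ 2, ((K $ 1)\<^sup>2 - (K $ 2)\<^sup>2) / P $ 2, 0]) / metric_inner P K K
     = 2 * metric_inner P (N q) (soliton_field \<delta> P)"
      using H K0 unfolding mean_curvature_orthonormal[of "sweep G c" q N, unfolded fund, OF refl refl refl K0]
        c11 c22 P[symmetric] by simp
  qed
qed

end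

text \<open>A vector \<open>(n, m)\<close> orthogonal to the unit vector \<open>(C, S)\<close> is a multiple of \<open>(- S, C)\<close>.\<close>

lemma orthogonal_in_plane:
  fixes C S m n :: real
  assumes "C\<^sup>2 + S\<^sup>2 = 1" "m * S + n * C = 0"
  shows "m = (m * C - n * S) * C" "n = - (m * C - n * S) * S"
proof -
  have "(m * C - n * S) * C = m * (C\<^sup>2 + S\<^sup>2) - S * (m * S + n * C)"
    by (simp add: power2_eq_square algebra_simps)
  then show "m = (m * C - n * S) * C" using assms by simp
  have "- (m * C - n * S) * S = n * (C\<^sup>2 + S\<^sup>2) - C * (m * S + n * C)"
    by (simp add: power2_eq_square algebra_simps)
  then show "n = - (m * C - n * S) * S" using assms by simp
qed

text \<open>In each group the normal \<open>N\<close> is a nonzero multiple \<open>\<nu>\<close> of the tangent \<open>(C, S)\<close> turned by a right angle in the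
  slice. The soliton equation is homogeneous in \<open>N\<close>, and division by \<open>\<nu>\<close> leaves an equation between
  \<open>C\<close>, \<open>S\<close> and their derivatives, which are written out in terms of \<open>\<gamma>''\<close>.
  Here the orbits are geodesics, and the summand \<open>C\<close> comes from the hyperbolic plane containing the curve.\<close>

lemma vertical_equation:
  assumes "swept_solution Vertical \<delta> I c \<gamma> v w" and s: "s \<in> I"
  defines "y \<equiv> \<gamma> s $ 2"
  defines "C \<equiv> v s $ 1 / y" and "S \<equiv> v s $ 2 / y"
  shows "C\<^sup>2 + S\<^sup>2 = 1"
    and "C * (w s $ 2 / y - S\<^sup>2) - S * (w s $ 1 / y - C * S) + C
      = 2 * (C * soliton_field \<delta> (\<gamma> s) $ 2 - S * soliton_field \<delta> (\<gamma> s) $ 1) / y"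
proof -
  interpret swept_solution Vertical \<delta> I c \<gamma> v w by fact
  have y: "0 < y" unfolding y_def using height_pos[OF s] .
  have "v s $ 3 = 0"
    by (rule derivative_of_constant[OF open_I s _ deriv(1)[OF s]]) (simp add: \<gamma>_def generating_curve_def)
  then show unit: "C\<^sup>2 + S\<^sup>2 = 1"
    using unit_speed[OF s] y by (simp add: C_def S_def power_divide y_def add_divide_distrib)
  define q :: "real^2" where "q = vector [s, 0]"
  define K where "K = killing_field Vertical (\<gamma> s)"
  have P: "\<gamma> s = sweep Vertical c q" using sweep_at_0[of q] by (simp add: q_def \<gamma>_def)
  have q: "q $ 1 = s" "1 = scale Vertical (q $ 2)" by (simp_all add: q_def scale_def)
  have K: "K $ 1 = 0" "K $ 2 = 0" "K $ 3 = 1" by (simp_all add: K_def killing_field_def)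
  have orth: "metric_inner (\<gamma> s) (stretch 1 (v s)) K = 0" and K0: "metric_inner (\<gamma> s) K K \<noteq> 0"
    using \<open>v s $ 3 = 0\<close> y by (simp_all add: metric_inner_eq K y_def)
  obtain N where N: "metric_inner (\<gamma> s) N N = 1" "metric_inner (\<gamma> s) N (stretch 1 (v s)) = 0"
    "metric_inner (\<gamma> s) N K = 0"
    and H: "metric_inner (\<gamma> s) N (vector [1 * (w s $ 1 - 2 * v s $ 1 * v s $ 2 / \<gamma> s $ 2),
        1 * (w s $ 2 + ((v s $ 1)\<^sup>2 - (v s $ 2)\<^sup>2) / \<gamma> s $ 2), w s $ 3])
     + metric_inner (\<gamma> s) N (killing_acceleration Vertical (\<gamma> s)
        + vector [- 2 * K $ 1 * K $ 2 / \<gamma> s $ 2, ((K $ 1)\<^sup>2 - (K $ 2)\<^sup>2) / \<gamma> s $ 2, 0]) / metric_inner (\<gamma> s) K K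
     = 2 * metric_inner (\<gamma> s) N (soliton_field \<delta> (\<gamma> s))"
    by (rule soliton_equation[OF q(1) s q(2) P K_def orth K0])
  have v: "v s $ 1 = y * C" "v s $ 2 = y * S" using y by (simp_all add: C_def S_def)
  define m n \<nu> where "m = N $ 2 / y" and "n = N $ 1 / y" and "\<nu> = m * C - n * S"
  have N3: "N $ 3 = 0" using N(3) by (simp add: metric_inner_eq K)
  have mn: "N $ 2 = y * m" "N $ 1 = y * n" using y by (simp_all add: m_def n_def)
  have "m * S + n * C = 0"
  proof -
    have "metric_inner (\<gamma> s) N (stretch 1 (v s)) = m * S + n * C"
      using y unfolding metric_inner_eq y_def[symmetric] v mn N3 stretch_1
      by (simp add: power2_eq_square field_simps)
    then show ?thesis using N(2) by simp
  qed
  then have m: "m = \<nu> * C" and n: "n = - \<nu> * S"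
    using orthogonal_in_plane[OF unit] by (simp_all add: \<nu>_def)
  have "\<nu> \<noteq> 0" using N(1) unfolding metric_inner_eq mn N3 by (auto simp: m n)
  moreover have "\<nu> * (C * (w s $ 2 / y - S\<^sup>2) - S * (w s $ 1 / y - C * S) + C)
      = \<nu> * (2 * (C * soliton_field \<delta> (\<gamma> s) $ 2 - S * soliton_field \<delta> (\<gamma> s) $ 1) / y)"
  proof -
    have "C = C * (C\<^sup>2 + S\<^sup>2)" using unit by simp
    then have "\<nu> * (C * (w s $ 2 / y - S\<^sup>2) - S * (w s $ 1 / y - C * S) + C)
       = \<nu> * (C * (w s $ 2 / y - S\<^sup>2) - S * (w s $ 1 / y - C * S) + C * (C\<^sup>2 + S\<^sup>2))"
      by metis
    also have "\<dots> = metric_inner (\<gamma> s) N (vector [1 * (w s $ 1 - 2 * v s $ 1 * v s $ 2 / \<gamma> s $ 2),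
        1 * (w s $ 2 + ((v s $ 1)\<^sup>2 - (v s $ 2)\<^sup>2) / \<gamma> s $ 2), w s $ 3])"
      using y unfolding metric_inner_eq y_def[symmetric] mn N3 v m n
      by (simp add: field_simps power2_eq_square power3_eq_cube)
    also have "\<dots> = 2 * metric_inner (\<gamma> s) N (soliton_field \<delta> (\<gamma> s))"
      using H by (simp add: metric_inner_eq K N3 killing_acceleration_def)
    also have "\<dots> = \<nu> * (2 * (C * soliton_field \<delta> (\<gamma> s) $ 2 - S * soliton_field \<delta> (\<gamma> s) $ 1) / y)"
      using y unfolding metric_inner_eq y_def[symmetric] mn N3 m n
      by (simp add: field_simps power2_eq_square)
    finally show ?thesis .
  qed
  ultimately show "C * (w s $ 2 / y - S\<^sup>2) - S * (w s $ 1 / y - C * S) + C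
      = 2 * (C * soliton_field \<delta> (\<gamma> s) $ 2 - S * soliton_field \<delta> (\<gamma> s) $ 1) / y"
    by (rule iffD1[OF mult_left_cancel])
qed

text \<open>The slice is flat and the summand \<open>C\<close> is the curvature of the orbits, which are horocycles.\<close>

lemma parabolic_equation:
  assumes "swept_solution Parabolic \<delta> I c \<gamma> v w" and s: "s \<in> I"
  defines "y \<equiv> \<gamma> s $ 2"
  defines "C \<equiv> v s $ 3" and "S \<equiv> v s $ 2 / y"
  shows "C\<^sup>2 + S\<^sup>2 = 1"
    and "C * (w s $ 2 / y - S\<^sup>2) - S * w s $ 3 + C
      = 2 * (C * soliton_field \<delta> (\<gamma> s) $ 2 / y - S * soliton_field \<delta> (\<gamma> s) $ 3)"
proof -
  interpret swept_solution Parabolic \<delta> I c \<gamma> v w by fact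
  have y: "0 < y" unfolding y_def using height_pos[OF s] .
  have v1: "v s $ 1 = 0"
    by (rule derivative_of_constant[OF open_I s _ deriv(1)[OF s]]) (simp add: \<gamma>_def generating_curve_def)
  then show unit: "C\<^sup>2 + S\<^sup>2 = 1"
    using unit_speed[OF s] y by (simp add: C_def S_def power_divide y_def)
  define q :: "real^2" where "q = vector [s, 0]"
  define K where "K = killing_field Parabolic (\<gamma> s)"
  have P: "\<gamma> s = sweep Parabolic c q" using sweep_at_0[of q] by (simp add: q_def \<gamma>_def)
  have q: "q $ 1 = s" "1 = scale Parabolic (q $ 2)" by (simp_all add: q_def scale_def)
  have K: "K $ 1 = 1" "K $ 2 = 0" "K $ 3 = 0" by (simp_all add: K_def killing_field_def)
  have orth: "metric_inner (\<gamma> s) (stretch 1 (v s)) K = 0" and K0: "metric_inner (\<gamma> s) K K \<noteq> 0"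
    using v1 y by (simp_all add: metric_inner_eq K y_def)
  obtain N where N: "metric_inner (\<gamma> s) N N = 1" "metric_inner (\<gamma> s) N (stretch 1 (v s)) = 0"
    "metric_inner (\<gamma> s) N K = 0"
    and H: "metric_inner (\<gamma> s) N (vector [1 * (w s $ 1 - 2 * v s $ 1 * v s $ 2 / \<gamma> s $ 2),
        1 * (w s $ 2 + ((v s $ 1)\<^sup>2 - (v s $ 2)\<^sup>2) / \<gamma> s $ 2), w s $ 3])
     + metric_inner (\<gamma> s) N (killing_acceleration Parabolic (\<gamma> s)
        + vector [- 2 * K $ 1 * K $ 2 / \<gamma> s $ 2, ((K $ 1)\<^sup>2 - (K $ 2)\<^sup>2) / \<gamma> s $ 2, 0]) / metric_inner (\<gamma> s) K K
     = 2 * metric_inner (\<gamma> s) N (soliton_field \<delta> (\<gamma> s))"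
    by (rule soliton_equation[OF q(1) s q(2) P K_def orth K0])
  have v2: "v s $ 2 = y * S" "v s $ 3 = C" using y by (simp_all add: C_def S_def)
  define m n \<nu> where "m = N $ 2 / y" and "n = N $ 3" and "\<nu> = m * C - n * S"
  have N1: "N $ 1 = 0" using N(3) y by (simp add: metric_inner_eq K y_def)
  have mn: "N $ 2 = y * m" "N $ 3 = n" using y by (simp_all add: m_def n_def)
  have "m * S + n * C = 0"
    using N(2) y unfolding metric_inner_eq y_def[symmetric] v1 v2 mn N1 stretch_1
    by (simp add: power2_eq_square field_simps)
  then have m: "m = \<nu> * C" and n: "n = - \<nu> * S"
    using orthogonal_in_plane[OF unit] by (simp_all add: \<nu>_def)
  have "\<nu> \<noteq> 0" using N(1) unfolding metric_inner_eq mn N1 by (auto simp: m n)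
  moreover have "\<nu> * (C * (w s $ 2 / y - S\<^sup>2) - S * w s $ 3 + C)
      = \<nu> * (2 * (C * soliton_field \<delta> (\<gamma> s) $ 2 / y - S * soliton_field \<delta> (\<gamma> s) $ 3))"
  proof -
    have "\<nu> * (C * (w s $ 2 / y - S\<^sup>2) - S * w s $ 3 + C)
      = metric_inner (\<gamma> s) N (vector [1 * (w s $ 1 - 2 * v s $ 1 * v s $ 2 / \<gamma> s $ 2),
        1 * (w s $ 2 + ((v s $ 1)\<^sup>2 - (v s $ 2)\<^sup>2) / \<gamma> s $ 2), w s $ 3])
     + metric_inner (\<gamma> s) N (killing_acceleration Parabolic (\<gamma> s)
        + vector [- 2 * K $ 1 * K $ 2 / \<gamma> s $ 2, ((K $ 1)\<^sup>2 - (K $ 2)\<^sup>2) / \<gamma> s $ 2, 0]) / metric_inner (\<gamma> s) K K"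
      using y unfolding metric_inner_eq y_def[symmetric] mn N1 v1 v2 K m n
      by (simp add: field_simps power2_eq_square killing_acceleration_def)
    also have "\<dots> = 2 * metric_inner (\<gamma> s) N (soliton_field \<delta> (\<gamma> s))" by (rule H)
    also have "\<dots> = \<nu> * (2 * (C * soliton_field \<delta> (\<gamma> s) $ 2 / y - S * soliton_field \<delta> (\<gamma> s) $ 3))"
      using y unfolding metric_inner_eq y_def[symmetric] mn N1 m n
      by (simp add: field_simps power2_eq_square)
    finally show ?thesis .
  qed
  ultimately show "C * (w s $ 2 / y - S\<^sup>2) - S * w s $ 3 + C
      = 2 * (C * soliton_field \<delta> (\<gamma> s) $ 2 / y - S * soliton_field \<delta> (\<gamma> s) $ 3)"
    by simp
qed

text \<open>The slice is the cylinder \<open>x\<^sup>2 + y\<^sup>2 = 1\<close>, and \<open>S\<close> is the speed along its circle: \<open>(x / y)' = S / y\<close>. The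
  summand \<open>- x C\<close> is the curvature of the orbits, which are equidistant curves of a geodesic.\<close>

lemma hyperbolic_equation:
  assumes "swept_solution Hyperbolic \<delta> I c \<gamma> v w" and s: "s \<in> I"
  defines "x \<equiv> \<gamma> s $ 1" and "y \<equiv> \<gamma> s $ 2"
  defines "C \<equiv> v s $ 3" and "S \<equiv> v s $ 1 - x * v s $ 2 / y"
  shows "x\<^sup>2 + y\<^sup>2 = 1" and "v s $ 1 = S * y\<^sup>2" and "v s $ 2 = - S * x * y"
    and "C\<^sup>2 + S\<^sup>2 = 1"
    and "C * (w s $ 1 - (v s $ 1 * v s $ 2 + x * w s $ 2) / y + x * (v s $ 2)\<^sup>2 / y\<^sup>2) - S * w s $ 3 - x * C
      = 2 * ((C * (y * soliton_field \<delta> (sweep Hyperbolic c (vector [s, t])) $ 1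
                   - x * soliton_field \<delta> (sweep Hyperbolic c (vector [s, t])) $ 2)) / (exp t * y)
             - S * soliton_field \<delta> (sweep Hyperbolic c (vector [s, t])) $ 3)"
proof -
  interpret swept_solution Hyperbolic \<delta> I c \<gamma> v w by fact
  have y: "0 < y" unfolding y_def using height_pos[OF s] .
  have circle: "(\<gamma> r $ 1)\<^sup>2 + (\<gamma> r $ 2)\<^sup>2 = 1" for r
    by (simp add: \<gamma>_def generating_curve_def)
  then show xy: "x\<^sup>2 + y\<^sup>2 = 1" by (simp add: x_def y_def)
  have "((\<lambda>r. (\<gamma> r $ 1)\<^sup>2 + (\<gamma> r $ 2)\<^sup>2) has_real_derivative 2 * (x * v s $ 1 + y * v s $ 2)) (at s)"
    by (rule derivative_eq_intros deriv(1)[OF s] refl)+ (simp add: x_def y_def algebra_simps)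
  then have "2 * (x * v s $ 1 + y * v s $ 2) = 0"
    by (rule derivative_of_constant[OF open_I s circle])
  then have tangent: "x * v s $ 1 + y * v s $ 2 = 0" by simp
  have "S * y\<^sup>2 = y\<^sup>2 * v s $ 1 - x * (y * v s $ 2)"
    using y by (simp add: S_def power2_eq_square field_simps)
  also have "\<dots> = (x\<^sup>2 + y\<^sup>2) * v s $ 1 - x * (x * v s $ 1 + y * v s $ 2)"
    by (simp add: power2_eq_square algebra_simps)
  finally show v1: "v s $ 1 = S * y\<^sup>2" using xy tangent by simp
  have "y * v s $ 2 = y * (- S * x * y)" using tangent unfolding v1 by (simp add: power2_eq_square algebra_simps)
  then show v2: "v s $ 2 = - S * x * y"
    by (rule iffD1[OF mult_left_cancel, rotated]) (use y in simp)
  have "((v s $ 1)\<^sup>2 + (v s $ 2)\<^sup>2) / y\<^sup>2 = S\<^sup>2 * (x\<^sup>2 + y\<^sup>2)"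
    using y unfolding v1 v2 by (simp add: field_simps power2_eq_square)
  then show unit: "C\<^sup>2 + S\<^sup>2 = 1"
    using unit_speed[OF s] xy by (simp add: C_def y_def)
  define q :: "real^2" where "q = vector [s, t]"
  define k where "k = exp t"
  define P where "P = sweep Hyperbolic c q"
  define K where "K = killing_field Hyperbolic P"
  have k: "0 < k" by (simp add: k_def)
  have q: "q $ 1 = s" "k = scale Hyperbolic (q $ 2)" by (simp_all add: q_def k_def scale_def)
  have P: "P $ 1 = k * x" "P $ 2 = k * y" by (simp_all add: P_def sweep_eq q_def k_def scale_def x_def y_def)
  have K: "K $ 1 = k * x" "K $ 2 = k * y" "K $ 3 = 0" by (simp_all add: K_def killing_field_def P)
  have acc: "killing_acceleration Hyperbolic P $ 1 = k * x" "killing_acceleration Hyperbolic P $ 2 = k * y"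
    "killing_acceleration Hyperbolic P $ 3 = 0" by (simp_all add: killing_acceleration_def P)
  have KK: "metric_inner P K K = 1 / y\<^sup>2"
  proof -
    have "metric_inner P K K = (x\<^sup>2 + y\<^sup>2) / y\<^sup>2"
      using k y by (simp add: metric_inner_eq K P field_simps power2_eq_square)
    then show ?thesis using xy by simp
  qed
  have orth: "metric_inner P (stretch k (v s)) K = 0"
  proof -
    have "metric_inner P (stretch k (v s)) K = (x * v s $ 1 + y * v s $ 2) / y\<^sup>2"
      using k y by (simp add: metric_inner_eq K P field_simps power2_eq_square)
    then show ?thesis using tangent by simp
  qed
  have K0: "metric_inner P K K \<noteq> 0" using KK y by simp
  obtain N where N: "metric_inner P N N = 1" "metric_inner P N (stretch k (v s)) = 0" "metric_inner P N K = 0"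
    and H: "metric_inner P N (vector [k * (w s $ 1 - 2 * v s $ 1 * v s $ 2 / \<gamma> s $ 2),
        k * (w s $ 2 + ((v s $ 1)\<^sup>2 - (v s $ 2)\<^sup>2) / \<gamma> s $ 2), w s $ 3])
     + metric_inner P N (killing_acceleration Hyperbolic P
        + vector [- 2 * K $ 1 * K $ 2 / P $ 2, ((K $ 1)\<^sup>2 - (K $ 2)\<^sup>2) / P $ 2, 0]) / metric_inner P K K
     = 2 * metric_inner P N (soliton_field \<delta> P)"
    by (rule soliton_equation[OF q(1) s q(2) P_def K_def orth K0])
  define m n \<nu> where "m = (N $ 1 * y - N $ 2 * x) / (k * y)" and "n = N $ 3" and "\<nu> = m * C - n * S"
  have Nxy: "N $ 1 * x + N $ 2 * y = 0"
  proof -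
    have "metric_inner P N K = (N $ 1 * x + N $ 2 * y) / (k * y\<^sup>2)"
      using k y by (simp add: metric_inner_eq K P field_simps power2_eq_square)
    then show ?thesis using N(3) k y by simp
  qed
  have kym: "k * y * m = N $ 1 * y - N $ 2 * x" using k y by (simp add: m_def)
  have N1: "N $ 1 = k * y * m * y"
  proof -
    have "k * y * m * y = N $ 1 * (x\<^sup>2 + y\<^sup>2) - x * (N $ 1 * x + N $ 2 * y)"
      unfolding kym by (simp add: power2_eq_square algebra_simps)
    then show ?thesis using xy Nxy by simp
  qed
  have N2: "N $ 2 = - (k * y * m * x)"
  proof -
    have "- (k * y * m * x) = N $ 2 * (x\<^sup>2 + y\<^sup>2) - y * (N $ 1 * x + N $ 2 * y)"
      unfolding kym by (simp add: power2_eq_square algebra_simps)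
    then show ?thesis using xy Nxy by simp
  qed
  have N3: "N $ 3 = n" by (simp add: n_def)
  have "m * S + n * C = 0"
  proof -
    have "metric_inner P N (stretch k (v s)) = m * S * (x\<^sup>2 + y\<^sup>2) + n * C"
      using k y unfolding metric_inner_eq stretch_nth P N1 N2 N3 v1 v2 C_def[symmetric]
      by (simp add: field_simps power2_eq_square)
    then show ?thesis using N(2) xy by simp
  qed
  then have m: "m = \<nu> * C" and n: "n = - \<nu> * S"
    using orthogonal_in_plane[OF unit] by (simp_all add: \<nu>_def)
  have "\<nu> \<noteq> 0" using N(1) unfolding metric_inner_eq N1 N2 N3 by (auto simp: m n)
  moreover define S1 where "S1 = w s $ 1 - (v s $ 1 * v s $ 2 + x * w s $ 2) / y + x * (v s $ 2)\<^sup>2 / y\<^sup>2"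
  moreover have "\<nu> * (C * S1 - S * w s $ 3 - x * C)
      = \<nu> * (2 * ((C * (y * soliton_field \<delta> P $ 1 - x * soliton_field \<delta> P $ 2)) / (k * y)
             - S * soliton_field \<delta> P $ 3))"
  proof -
    have "metric_inner P N (vector [k * (w s $ 1 - 2 * v s $ 1 * v s $ 2 / \<gamma> s $ 2),
        k * (w s $ 2 + ((v s $ 1)\<^sup>2 - (v s $ 2)\<^sup>2) / \<gamma> s $ 2), w s $ 3])
      = m * (S1 - v s $ 1 * (x * v s $ 1 + y * v s $ 2) / y\<^sup>2) + n * w s $ 3"
      using k y unfolding metric_inner_eq P N1 N2 N3 S1_def y_def[symmetric]
      by (simp add: field_simps power2_eq_square power3_eq_cube)
    also have "\<dots> = m * S1 + n * w s $ 3" using tangent by simp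
    finally have A: "metric_inner P N (vector [k * (w s $ 1 - 2 * v s $ 1 * v s $ 2 / \<gamma> s $ 2),
        k * (w s $ 2 + ((v s $ 1)\<^sup>2 - (v s $ 2)\<^sup>2) / \<gamma> s $ 2), w s $ 3]) = m * S1 + n * w s $ 3" .
    have "metric_inner P N (killing_acceleration Hyperbolic P
        + vector [- 2 * K $ 1 * K $ 2 / P $ 2, ((K $ 1)\<^sup>2 - (K $ 2)\<^sup>2) / P $ 2, 0]) / metric_inner P K K
      = - (m * x) * (x\<^sup>2 + y\<^sup>2)"
      using k y unfolding metric_inner_eq[of P N] KK P K N1 N2 N3
      by (simp add: acc field_simps power2_eq_square power3_eq_cube)
    also have "\<dots> = - (m * x)" using xy by simp
    finally have B: "metric_inner P N (killing_acceleration Hyperbolic P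
        + vector [- 2 * K $ 1 * K $ 2 / P $ 2, ((K $ 1)\<^sup>2 - (K $ 2)\<^sup>2) / P $ 2, 0]) / metric_inner P K K
      = - (m * x)" .
    have "\<nu> * (C * S1 - S * w s $ 3 - x * C) = m * S1 + n * w s $ 3 - m * x"
      by (simp add: m n algebra_simps)
    also have "\<dots> = 2 * metric_inner P N (soliton_field \<delta> P)" using H unfolding A B by simp
    also have "\<dots> = \<nu> * (2 * ((C * (y * soliton_field \<delta> P $ 1 - x * soliton_field \<delta> P $ 2)) / (k * y)
             - S * soliton_field \<delta> P $ 3))"
      using k y unfolding metric_inner_eq P N1 N2 N3 m n
      by (simp add: field_simps power2_eq_square)
    finally show ?thesis .
  qed
  ultimately have "C * S1 - S * w s $ 3 - x * C
      = 2 * ((C * (y * soliton_field \<delta> P $ 1 - x * soliton_field \<delta> P $ 2)) / (k * y)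
             - S * soliton_field \<delta> P $ 3)" by simp
  then show "C * (w s $ 1 - (v s $ 1 * v s $ 2 + x * w s $ 2) / y + x * (v s $ 2)\<^sup>2 / y\<^sup>2) - S * w s $ 3 - x * C
      = 2 * ((C * (y * soliton_field \<delta> (sweep Hyperbolic c (vector [s, t])) $ 1
                   - x * soliton_field \<delta> (sweep Hyperbolic c (vector [s, t])) $ 2)) / (exp t * y)
             - S * soliton_field \<delta> (sweep Hyperbolic c (vector [s, t])) $ 3)"
    unfolding S1_def P_def q_def k_def .
qed

section \<open>The generating curves as profile curves\<close>

text \<open>A unit vector turns orthogonally to itself, so its derivative is determined by the scalar curvature equation.\<close>

lemma profile_curveI:
  fixes p q A B a b C S C' S' :: "real \<Rightarrow> real"
  assumes I: "open I" "is_interval I"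
    and pos: "\<And>s. s \<in> I \<Longrightarrow> 0 < p (b s)" "\<And>s. s \<in> I \<Longrightarrow> 0 < q (b s)"
    and cont: "continuous_on I (\<lambda>s. q (b s))" "continuous_on I (\<lambda>s. A (b s))" "continuous_on I (\<lambda>s. B (b s))"
    and a: "\<And>s. s \<in> I \<Longrightarrow> (a has_real_derivative p (b s) * C s) (at s)"
    and b: "\<And>s. s \<in> I \<Longrightarrow> (b has_real_derivative q (b s) * S s) (at s)"
    and C: "\<And>s. s \<in> I \<Longrightarrow> (C has_real_derivative C' s) (at s)"
    and S: "\<And>s. s \<in> I \<Longrightarrow> (S has_real_derivative S' s) (at s)"
    and unit: "\<And>s. s \<in> I \<Longrightarrow> (C s)\<^sup>2 + (S s)\<^sup>2 = 1"
    and curvature: "\<And>s. s \<in> I \<Longrightarrow> C s * S' s - S s * C' s = A (b s) * C s + B (b s) * S s"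
  shows "profile_curve I p q A B a b C S"
proof
  fix s assume s: "s \<in> I"
  define \<kappa> where "\<kappa> = A (b s) * C s + B (b s) * S s"
  have "((\<lambda>s. (C s)\<^sup>2 + (S s)\<^sup>2) has_real_derivative 2 * (C s * C' s + S s * S' s)) (at s)"
    by (rule derivative_eq_intros C[OF s] S[OF s] refl)+ (simp add: algebra_simps)
  then have "2 * (C s * C' s + S s * S' s) = 0"
    using derivative_of_constant[where f = "\<lambda>s. (C s)\<^sup>2 + (S s)\<^sup>2", OF I(1) s] unit by blast
  then have perp: "C s * C' s + S s * S' s = 0" by simp
  have \<kappa>: "C s * S' s - S s * C' s = \<kappa>" using curvature[OF s] by (simp add: \<kappa>_def)
  have "C' s = C' s * ((C s)\<^sup>2 + (S s)\<^sup>2)" using unit[OF s] by simp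
  also have "\<dots> = C s * (C s * C' s + S s * S' s) - S s * (C s * S' s - S s * C' s)"
    by (simp add: power2_eq_square algebra_simps)
  finally have "C' s = - S s * \<kappa>" using perp \<kappa> by simp
  then show "(C has_real_derivative - S s * (A (b s) * C s + B (b s) * S s)) (at s)"
    using C[OF s] by (simp add: \<kappa>_def)
  have "S' s = S' s * ((C s)\<^sup>2 + (S s)\<^sup>2)" using unit[OF s] by simp
  also have "\<dots> = S s * (C s * C' s + S s * S' s) + C s * (C s * S' s - S s * C' s)"
    by (simp add: power2_eq_square algebra_simps)
  finally have "S' s = C s * \<kappa>" using perp \<kappa> by simp
  then show "(S has_real_derivative C s * (A (b s) * C s + B (b s) * S s)) (at s)"
    using S[OF s] by (simp add: \<kappa>_def)
qed (use assms in blast)+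

text \<open>A field that generates the homotheties is invariant under these rather than under horizontal translations. With
  \<open>a = ln \<rho>\<close> and \<open>b = x / y\<close>, the cotangent of the polar angle, homotheties become translations of \<open>a\<close>. The new
  tangent \<open>(C, S)\<close> consists of the radial and the clockwise component of the old one \<open>(c\<^sub>0, s\<^sub>0)\<close>; the rotation of
  the polar frame contributes \<open>- y S / \<rho>\<close> to its curvature.\<close>

lemma polar_profile_curve:
  fixes x y c\<^sub>0 s\<^sub>0 c\<^sub>1 s\<^sub>1 :: "real \<Rightarrow> real"
  assumes I: "open I" "is_interval I"
    and y: "\<And>s. s \<in> I \<Longrightarrow> 0 < y s"
    and dx: "\<And>s. s \<in> I \<Longrightarrow> (x has_real_derivative y s * c\<^sub>0 s) (at s)"
    and dy: "\<And>s. s \<in> I \<Longrightarrow> (y has_real_derivative y s * s\<^sub>0 s) (at s)"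
    and dc: "\<And>s. s \<in> I \<Longrightarrow> (c\<^sub>0 has_real_derivative c\<^sub>1 s) (at s)"
    and ds: "\<And>s. s \<in> I \<Longrightarrow> (s\<^sub>0 has_real_derivative s\<^sub>1 s) (at s)"
    and unit: "\<And>s. s \<in> I \<Longrightarrow> (c\<^sub>0 s)\<^sup>2 + (s\<^sub>0 s)\<^sup>2 = 1"
    and curvature: "\<And>s. s \<in> I \<Longrightarrow> c\<^sub>0 s * s\<^sub>1 s - s\<^sub>0 s * c\<^sub>1 s
      = - c\<^sub>0 s + 2 * (c\<^sub>0 s * y s - s\<^sub>0 s * x s) / y s"
  shows "profile_curve I (\<lambda>\<beta>. 1 / sqrt (1 + \<beta>\<^sup>2)) (\<lambda>\<beta>. sqrt (1 + \<beta>\<^sup>2)) (\<lambda>\<beta>. \<beta> / sqrt (1 + \<beta>\<^sup>2))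
    (\<lambda>\<beta>. - 2 * sqrt (1 + \<beta>\<^sup>2)) (\<lambda>s. ln ((x s)\<^sup>2 + (y s)\<^sup>2) / 2) (\<lambda>s. x s / y s)
    (\<lambda>s. (x s * c\<^sub>0 s + y s * s\<^sub>0 s) / sqrt ((x s)\<^sup>2 + (y s)\<^sup>2))
    (\<lambda>s. (y s * c\<^sub>0 s - x s * s\<^sub>0 s) / sqrt ((x s)\<^sup>2 + (y s)\<^sup>2))"
proof -
  define \<rho> where "\<rho> s = sqrt ((x s)\<^sup>2 + (y s)\<^sup>2)" for s
  define C where "C s = (x s * c\<^sub>0 s + y s * s\<^sub>0 s) / \<rho> s" for s
  define S where "S s = (y s * c\<^sub>0 s - x s * s\<^sub>0 s) / \<rho> s" for s
  have r2: "(\<rho> s)\<^sup>2 = (x s)\<^sup>2 + (y s)\<^sup>2" for s by (simp add: \<rho>_def)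
  have \<rho>: "0 < \<rho> s" if "s \<in> I" for s
    using y[OF that] by (simp add: \<rho>_def add_nonneg_pos)
  have CS: "\<rho> s * C s = x s * c\<^sub>0 s + y s * s\<^sub>0 s" "\<rho> s * S s = y s * c\<^sub>0 s - x s * s\<^sub>0 s" if "s \<in> I" for s
    using \<rho>[OF that] by (simp_all add: C_def S_def)
  have unit': "(C s)\<^sup>2 + (S s)\<^sup>2 = 1" if s: "s \<in> I" for s
  proof -
    have "(\<rho> s)\<^sup>2 * ((C s)\<^sup>2 + (S s)\<^sup>2) = (\<rho> s * C s)\<^sup>2 + (\<rho> s * S s)\<^sup>2"
      by (simp add: power_mult_distrib algebra_simps)
    also have "\<dots> = ((x s)\<^sup>2 + (y s)\<^sup>2) * ((c\<^sub>0 s)\<^sup>2 + (s\<^sub>0 s)\<^sup>2)"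
      unfolding CS[OF s] by (simp add: power2_eq_square algebra_simps)
    finally show ?thesis using \<rho>[OF s] unit[OF s] by (simp add: r2[symmetric])
  qed
  have inverse_rotation: "C s * x s + S s * y s = \<rho> s * c\<^sub>0 s" "C s * y s - S s * x s = \<rho> s * s\<^sub>0 s" if s: "s \<in> I" for s
  proof -
    have "\<rho> s * (C s * x s + S s * y s) = x s * (\<rho> s * C s) + y s * (\<rho> s * S s)"
      by (simp add: algebra_simps)
    also have "\<dots> = \<rho> s * (\<rho> s * c\<^sub>0 s)"
      unfolding CS[OF s] mult.assoc[symmetric] power2_eq_square[symmetric] r2 by (simp add: power2_eq_square algebra_simps)
    finally show "C s * x s + S s * y s = \<rho> s * c\<^sub>0 s" using \<rho>[OF s] by simp
    have "\<rho> s * (C s * y s - S s * x s) = y s * (\<rho> s * C s) - x s * (\<rho> s * S s)"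
      by (simp add: algebra_simps)
    also have "\<dots> = \<rho> s * (\<rho> s * s\<^sub>0 s)"
      unfolding CS[OF s] mult.assoc[symmetric] power2_eq_square[symmetric] r2 by (simp add: power2_eq_square algebra_simps)
    finally show "C s * y s - S s * x s = \<rho> s * s\<^sub>0 s" using \<rho>[OF s] by simp
  qed
  have sqrt: "sqrt (1 + (x s / y s)\<^sup>2) = \<rho> s / y s" if s: "s \<in> I" for s
  proof (rule real_sqrt_unique)
    show "(\<rho> s / y s)\<^sup>2 = 1 + (x s / y s)\<^sup>2"
      using y[OF s] by (simp add: power_divide r2 field_simps)
  qed (use y[OF s] \<rho>[OF s] in simp)
  have dr2: "((\<lambda>s. (x s)\<^sup>2 + (y s)\<^sup>2) has_real_derivative
      2 * x s * (y s * c\<^sub>0 s) + 2 * y s * (y s * s\<^sub>0 s)) (at s)" if s: "s \<in> I" for s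
    by (rule derivative_eq_intros dx[OF s] dy[OF s] refl)+ simp
  have d\<rho>: "(\<rho> has_real_derivative y s * C s) (at s)" if s: "s \<in> I" for s
  proof -
    have "0 < (x s)\<^sup>2 + (y s)\<^sup>2" using \<rho>[OF s] unfolding r2[symmetric] by simp
    with dr2[OF s] have "(\<rho> has_real_derivative
        inverse (\<rho> s) / 2 * (2 * x s * (y s * c\<^sub>0 s) + 2 * y s * (y s * s\<^sub>0 s))) (at s)"
      unfolding \<rho>_def[abs_def] by (intro DERIV_chain2[OF DERIV_real_sqrt])
    moreover have "inverse (\<rho> s) / 2 * (2 * x s * (y s * c\<^sub>0 s) + 2 * y s * (y s * s\<^sub>0 s)) = y s * C s"
      using \<rho>[OF s] by (simp add: C_def field_simps)
    ultimately show ?thesis by simp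
  qed
  define C' where "C' s = (y s * (S s)\<^sup>2 + x s * c\<^sub>1 s + y s * s\<^sub>1 s) / \<rho> s" for s
  define S' where "S' s = (y s * c\<^sub>1 s - x s * s\<^sub>1 s - y s * C s * S s) / \<rho> s" for s
  have "profile_curve I (\<lambda>\<beta>. 1 / sqrt (1 + \<beta>\<^sup>2)) (\<lambda>\<beta>. sqrt (1 + \<beta>\<^sup>2)) (\<lambda>\<beta>. \<beta> / sqrt (1 + \<beta>\<^sup>2))
    (\<lambda>\<beta>. - 2 * sqrt (1 + \<beta>\<^sup>2)) (\<lambda>s. ln ((x s)\<^sup>2 + (y s)\<^sup>2) / 2) (\<lambda>s. x s / y s) C S"
  proof (rule profile_curveI[OF I, where C' = C' and S' = S'])
    fix s assume s: "s \<in> I"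
    note y = y[OF s] and \<rho> = \<rho>[OF s]
    show "0 < 1 / sqrt (1 + (x s / y s)\<^sup>2)" "0 < sqrt (1 + (x s / y s)\<^sup>2)"
      unfolding sqrt[OF s] using y \<rho> by simp_all
    have "0 < (x s)\<^sup>2 + (y s)\<^sup>2" using \<rho> unfolding r2[symmetric] by simp
    with dr2[OF s] have "((\<lambda>s. ln ((x s)\<^sup>2 + (y s)\<^sup>2) / 2) has_real_derivative
        1 / ((x s)\<^sup>2 + (y s)\<^sup>2) * (2 * x s * (y s * c\<^sub>0 s) + 2 * y s * (y s * s\<^sub>0 s)) / 2) (at s)"
      by (intro DERIV_cdivide DERIV_chain2[OF DERIV_ln_divide])
    moreover have "1 / ((x s)\<^sup>2 + (y s)\<^sup>2) * (2 * x s * (y s * c\<^sub>0 s) + 2 * y s * (y s * s\<^sub>0 s)) / 2 = 1 / (\<rho> s / y s) * C s"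
      unfolding r2[symmetric] using \<rho> y by (simp add: C_def field_simps power2_eq_square)
    ultimately show "((\<lambda>s. ln ((x s)\<^sup>2 + (y s)\<^sup>2) / 2) has_real_derivative 1 / sqrt (1 + (x s / y s)\<^sup>2) * C s) (at s)"
      unfolding sqrt[OF s] by simp
    have "((\<lambda>s. x s / y s) has_real_derivative (y s * c\<^sub>0 s * y s - x s * (y s * s\<^sub>0 s)) / (y s * y s)) (at s)"
      using y by (intro DERIV_divide dx dy s) simp
    moreover have "(y s * c\<^sub>0 s * y s - x s * (y s * s\<^sub>0 s)) / (y s * y s) = \<rho> s / y s * S s"
      using \<rho> y by (simp add: S_def field_simps)
    ultimately show "((\<lambda>s. x s / y s) has_real_derivative sqrt (1 + (x s / y s)\<^sup>2) * S s) (at s)"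
      unfolding sqrt[OF s] by simp
    show "(C s)\<^sup>2 + (S s)\<^sup>2 = 1" using unit'[OF s] .
    have "((\<lambda>s. (x s * c\<^sub>0 s + y s * s\<^sub>0 s) / \<rho> s) has_real_derivative
        (((y s * c\<^sub>0 s * c\<^sub>0 s + x s * c\<^sub>1 s) + (y s * s\<^sub>0 s * s\<^sub>0 s + y s * s\<^sub>1 s)) * \<rho> s
        - (x s * c\<^sub>0 s + y s * s\<^sub>0 s) * (y s * C s)) / (\<rho> s * \<rho> s)) (at s)"
      by (rule DERIV_divide) (use \<rho> in \<open>auto intro!: derivative_eq_intros dx dy dc ds s d\<rho>\<close>)
    then have "(C has_real_derivative (((y s * c\<^sub>0 s * c\<^sub>0 s + x s * c\<^sub>1 s) + (y s * s\<^sub>0 s * s\<^sub>0 s + y s * s\<^sub>1 s)) * \<rho> s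
        - (x s * c\<^sub>0 s + y s * s\<^sub>0 s) * (y s * C s)) / (\<rho> s * \<rho> s)) (at s)"
      by (simp only: C_def[abs_def])
    moreover have "(((y s * c\<^sub>0 s * c\<^sub>0 s + x s * c\<^sub>1 s) + (y s * s\<^sub>0 s * s\<^sub>0 s + y s * s\<^sub>1 s)) * \<rho> s
        - (x s * c\<^sub>0 s + y s * s\<^sub>0 s) * (y s * C s)) / (\<rho> s * \<rho> s) = C' s"
    proof -
      have "((y s * c\<^sub>0 s * c\<^sub>0 s + x s * c\<^sub>1 s) + (y s * s\<^sub>0 s * s\<^sub>0 s + y s * s\<^sub>1 s)) * \<rho> s
        - (x s * c\<^sub>0 s + y s * s\<^sub>0 s) * (y s * C s)
        = \<rho> s * (y s * ((c\<^sub>0 s)\<^sup>2 + (s\<^sub>0 s)\<^sup>2) + x s * c\<^sub>1 s + y s * s\<^sub>1 s - y s * (C s)\<^sup>2)"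
        unfolding CS(1)[OF s, symmetric] by (simp add: power2_eq_square algebra_simps)
      also have "\<dots> = \<rho> s * (y s * (S s)\<^sup>2 + x s * c\<^sub>1 s + y s * s\<^sub>1 s)"
        unfolding unit[OF s] unit'[OF s, symmetric] by (simp add: algebra_simps)
      finally show ?thesis using \<rho> by (simp add: C'_def)
    qed
    ultimately show "(C has_real_derivative C' s) (at s)" by simp
    have "(S has_real_derivative (((y s * s\<^sub>0 s * c\<^sub>0 s + y s * c\<^sub>1 s) - (y s * c\<^sub>0 s * s\<^sub>0 s + x s * s\<^sub>1 s)) * \<rho> s
        - (y s * c\<^sub>0 s - x s * s\<^sub>0 s) * (y s * C s)) / (\<rho> s * \<rho> s)) (at s)"
      unfolding S_def[abs_def]
      by (rule DERIV_divide) (use \<rho> in \<open>auto intro!: derivative_eq_intros dx dy dc ds s d\<rho>\<close>)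
    moreover have "(((y s * s\<^sub>0 s * c\<^sub>0 s + y s * c\<^sub>1 s) - (y s * c\<^sub>0 s * s\<^sub>0 s + x s * s\<^sub>1 s)) * \<rho> s
        - (y s * c\<^sub>0 s - x s * s\<^sub>0 s) * (y s * C s)) / (\<rho> s * \<rho> s) = S' s"
      unfolding CS(2)[OF s, symmetric] using \<rho> by (simp add: S'_def field_simps)
    ultimately show "(S has_real_derivative S' s) (at s)" by simp
    have "C s * S' s - S s * C' s = ((C s * y s - S s * x s) * c\<^sub>1 s - (C s * x s + S s * y s) * s\<^sub>1 s
        - y s * S s * ((C s)\<^sup>2 + (S s)\<^sup>2)) / \<rho> s"
      using \<rho> by (simp add: C'_def S'_def field_simps power2_eq_square)
    also have "\<dots> = - (c\<^sub>0 s * s\<^sub>1 s - s\<^sub>0 s * c\<^sub>1 s) - y s * S s / \<rho> s"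
      unfolding inverse_rotation[OF s] unit'[OF s] using \<rho> by (simp add: field_simps)
    also have "\<dots> = c\<^sub>0 s - 2 * (\<rho> s * S s) / y s - y s * S s / \<rho> s"
      unfolding curvature[OF s] CS(2)[OF s] by (simp add: mult.commute)
    also have "c\<^sub>0 s = (C s * x s + S s * y s) / \<rho> s"
      unfolding inverse_rotation(1)[OF s] using \<rho> by simp
    also have "(C s * x s + S s * y s) / \<rho> s - 2 * (\<rho> s * S s) / y s - y s * S s / \<rho> s
        = x s / y s / (\<rho> s / y s) * C s + - 2 * (\<rho> s / y s) * S s"
      using \<rho> y by (simp add: field_simps)
    finally show "C s * S' s - S s * C' s = x s / y s / sqrt (1 + (x s / y s)\<^sup>2) * C s + - 2 * sqrt (1 + (x s / y s)\<^sup>2) * S s"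
      unfolding sqrt[OF s] .
  next
    have b: "continuous_on I (\<lambda>s. x s / y s)"
      by (intro continuous_on_divide continuous_at_imp_continuous_on ballI DERIV_isCont[OF dx] DERIV_isCont[OF dy])
        (use y in force)+
    have nz: "sqrt (1 + r\<^sup>2) \<noteq> 0" for r :: real
      by (simp add: add_nonneg_eq_0_iff)
    show "continuous_on I (\<lambda>s. sqrt (1 + (x s / y s)\<^sup>2))"
      "continuous_on I (\<lambda>s. x s / y s / sqrt (1 + (x s / y s)\<^sup>2))"
      "continuous_on I (\<lambda>s. - 2 * sqrt (1 + (x s / y s)\<^sup>2))"
      by (intro continuous_intros b ballI nz)+
  qed
  then show ?thesis unfolding C_def[abs_def] S_def[abs_def] \<rho>_def .
qed

text \<open>This function is the cosine of the polar angle with cotangent \<open>\<beta>\<close>; it changes sign at the geodesic \<open>x = 0\<close>.\<close>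

lemma tilted_sign_conditions:
  fixes A :: "real \<Rightarrow> real"
  defines "A \<equiv> \<lambda>\<beta>. \<beta> / sqrt (1 + \<beta>\<^sup>2)"
  shows "(\<forall>x y. A x < 0 \<longrightarrow> y \<le> x \<longrightarrow> A y < 0) \<and> (\<forall>x y. 0 < A x \<longrightarrow> x \<le> y \<longrightarrow> 0 < A y) \<and>
    (\<forall>x y. A x = 0 \<longrightarrow> \<bar>A y\<bar> \<le> \<bar>y - x\<bar>)"
proof -
  have pos: "0 < sqrt (1 + r\<^sup>2)" for r :: real
    by (intro real_sqrt_gt_zero add_pos_nonneg) auto
  have sign: "A r < 0 \<longleftrightarrow> r < 0" "0 < A r \<longleftrightarrow> 0 < r" "A r = 0 \<longleftrightarrow> r = 0" for r
    using pos[of r] unfolding A_def by (auto simp: divide_less_0_iff zero_less_divide_iff)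
  have "\<bar>A r\<bar> \<le> \<bar>r\<bar>" for r
  proof -
    have "1 \<le> sqrt (1 + r\<^sup>2)" by simp
    then have "\<bar>r\<bar> / sqrt (1 + r\<^sup>2) \<le> \<bar>r\<bar> / 1" using pos[of r] by (intro divide_left_mono) auto
    then show ?thesis using pos[of r] by (simp add: A_def)
  qed
  then show ?thesis unfolding sign by auto
qed

context swept_solution
begin

text \<open>The maps \<open>\<pi>\<close> to the orbit space and \<open>\<tau>\<close> to the time along the orbit are continuous on the ambient space. They
  turn a continuous inverse of the profile curve into a continuous inverse of the whole immersion, so that the image
  is a single sheet: in the definition of an embedded surface one may take the neighbourhood to be the whole space.\<close>

lemma embedded_if_profile_embedded:
  fixes \<pi> :: "real^3 \<Rightarrow> real \<times> real" and \<tau> :: "real^3 \<Rightarrow> real" and k :: "real \<Rightarrow> real \<times> real"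
  assumes cont: "continuous_on HR \<pi>" "continuous_on HR \<tau>"
    and inv: "\<And>q. q \<in> sweep_domain I \<Longrightarrow> \<pi> (sweep G c q) = k (q $ 1)"
      "\<And>q. q \<in> sweep_domain I \<Longrightarrow> \<tau> (sweep G c q) = q $ 2"
    and k: "\<exists>g. continuous_on (k ` I) g \<and> (\<forall>s\<in>I. g (k s) = s)"
  shows "embedded_surface (sweep_domain I) (sweep G c) \<and> no_self_intersections I (generating_curve G c)"
proof -
  let ?U = "sweep_domain I" and ?\<Psi> = "sweep G c"
  obtain g where g: "continuous_on (k ` I) g" "\<And>s. s \<in> I \<Longrightarrow> g (k s) = s" using k by blast
  define \<Phi> :: "real^3 \<Rightarrow> real^2" where "\<Phi> P = (\<chi> i. if i = 1 then g (\<pi> P) else \<tau> P)" for P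
  have HR: "?\<Psi> ` ?U \<subseteq> HR" and smooth: "smooth_on ?U ?\<Psi>"
    using immersed by (simp_all add: immersed_surface_def)
  have \<Phi>: "\<Phi> (?\<Psi> q) = q" if "q \<in> ?U" for q
    using that g(2)[of "q $ 1"] inv[OF that]
    by (simp add: \<Phi>_def vec_eq_iff forall_2 sweep_domain_def)
  have "continuous_on (?\<Psi> ` ?U) (\<lambda>P. g (\<pi> P))"
    by (rule continuous_on_compose2[OF g(1) continuous_on_subset[OF cont(1) HR]])
      (use inv(1) in \<open>auto simp: sweep_domain_def\<close>)
  moreover have "continuous_on (?\<Psi> ` ?U) \<tau>" by (rule continuous_on_subset[OF cont(2) HR])
  ultimately have "continuous_on (?\<Psi> ` ?U) (\<lambda>P. if i = (1::2) then g (\<pi> P) else \<tau> P)" for i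
    by (cases "i = 1") simp_all
  then have cont_\<Phi>: "continuous_on (?\<Psi> ` ?U) \<Phi>"
    unfolding \<Phi>_def[abs_def] by (intro continuous_on_vec_lambda)
  have "iterated_partial [] ?\<Psi> = ?\<Psi>" by simp
  then have cont_\<Psi>: "continuous_on ?U ?\<Psi>"
    using smooth unfolding smooth_on_def by metis
  have hom: "homeomorphism ?U (?\<Psi> ` ?U \<inter> UNIV) ?\<Psi> \<Phi>"
    unfolding homeomorphism_def using cont_\<Psi> cont_\<Phi> \<Phi> by (auto simp: image_iff)
  have "open ?U" using smooth by (simp add: smooth_on_def)
  then have "embedded_surface ?U ?\<Psi>"
    unfolding embedded_surface_def using immersed hom by blast
  moreover have "inj_on (generating_curve G c) I"
  proof (rule inj_onI)
    fix s t assume st: "s \<in> I" "t \<in> I" "generating_curve G c s = generating_curve G c t"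
    define q :: "real \<Rightarrow> real^2" where "q r = vector [r, 0]" for r
    have q: "q r $ 1 = r" "q r $ 2 = 0" "r \<in> I \<Longrightarrow> q r \<in> ?U" for r by (simp_all add: q_def sweep_domain_def)
    have "?\<Psi> (q s) = ?\<Psi> (q t)" using st(3) by (simp add: sweep_at_0 q)
    then have "q s = q t" using \<Phi>[OF q(3)] st by metis
    then show "s = t" using q(1) by metis
  qed
  ultimately show ?thesis unfolding no_self_intersections_def by blast
qed

end

lemma HR_continuous_intros:
  "continuous_on HR (\<lambda>p. p $ i)" "p \<in> HR \<Longrightarrow> p $ 2 \<noteq> 0" "p \<in> HR \<Longrightarrow> (p $ 1)\<^sup>2 + (p $ 2)\<^sup>2 \<noteq> 0"
  by (auto simp: HR_def sum_power2_eq_zero_iff intro!: continuous_intros)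

text \<open>Away from the type of the homotheties \<open>\<kappa> = - C + (e C + f S) / y\<close>, where \<open>e\<close> comes from \<open>\<plusminus> \<partial>\<^sub>y\<close> and
  \<open>f\<close> from \<open>\<partial>\<^sub>x\<close>; at most one of them is nonzero.\<close>

lemma vertical_embedded:
  assumes "swept_solution Vertical \<delta> I c \<gamma> v w"
  shows "embedded_surface (sweep_domain I) (sweep Vertical c) \<and> no_self_intersections I (generating_curve Vertical c)"
proof -
  interpret swept_solution Vertical \<delta> I c \<gamma> v w by fact
  define C S where "C s = v s $ 1 / \<gamma> s $ 2" and "S s = v s $ 2 / \<gamma> s $ 2" for s
  note eq = vertical_equation[OF assms, folded C_def S_def]
  have dx: "((\<lambda>s. \<gamma> s $ 1) has_real_derivative \<gamma> s $ 2 * C s) (at s)"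
    and dy: "((\<lambda>s. \<gamma> s $ 2) has_real_derivative \<gamma> s $ 2 * S s) (at s)" if "s \<in> I" for s
    using deriv(1)[OF that] height_pos[OF that] by (simp_all add: C_def S_def)
  have dC: "(C has_real_derivative w s $ 1 / \<gamma> s $ 2 - C s * S s) (at s)" if s: "s \<in> I" for s
  proof -
    have "(C has_real_derivative (w s $ 1 * \<gamma> s $ 2 - v s $ 1 * v s $ 2) / (\<gamma> s $ 2 * \<gamma> s $ 2)) (at s)"
      unfolding C_def[abs_def] by (intro DERIV_divide deriv s) (use height_pos[OF s] in simp)
    then show ?thesis using height_pos[OF s] by (simp add: C_def S_def diff_divide_distrib)
  qed
  have dS: "(S has_real_derivative w s $ 2 / \<gamma> s $ 2 - (S s)\<^sup>2) (at s)" if s: "s \<in> I" for s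
  proof -
    have "(S has_real_derivative (w s $ 2 * \<gamma> s $ 2 - v s $ 2 * v s $ 2) / (\<gamma> s $ 2 * \<gamma> s $ 2)) (at s)"
      unfolding S_def[abs_def] by (intro DERIV_divide deriv s) (use height_pos[OF s] in simp)
    then show ?thesis using height_pos[OF s] by (simp add: S_def diff_divide_distrib power2_eq_square)
  qed
  have sweep: "sweep Vertical c q $ 1 = \<gamma> (q $ 1) $ 1" "sweep Vertical c q $ 2 = \<gamma> (q $ 1) $ 2"
    "sweep Vertical c q $ 3 = q $ 2" for q
    by (simp_all add: sweep_def \<gamma>_def generating_curve_def)
  show ?thesis
  proof (cases "\<delta> = H_type")
    case True
    interpret profile_curve I "\<lambda>\<beta>. 1 / sqrt (1 + \<beta>\<^sup>2)" "\<lambda>\<beta>. sqrt (1 + \<beta>\<^sup>2)" "\<lambda>\<beta>. \<beta> / sqrt (1 + \<beta>\<^sup>2)"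
      "\<lambda>\<beta>. - 2 * sqrt (1 + \<beta>\<^sup>2)" "\<lambda>s. ln ((\<gamma> s $ 1)\<^sup>2 + (\<gamma> s $ 2)\<^sup>2) / 2" "\<lambda>s. \<gamma> s $ 1 / \<gamma> s $ 2"
      "\<lambda>s. (\<gamma> s $ 1 * C s + \<gamma> s $ 2 * S s) / sqrt ((\<gamma> s $ 1)\<^sup>2 + (\<gamma> s $ 2)\<^sup>2)"
      "\<lambda>s. (\<gamma> s $ 2 * C s - \<gamma> s $ 1 * S s) / sqrt ((\<gamma> s $ 1)\<^sup>2 + (\<gamma> s $ 2)\<^sup>2)"
      by (rule polar_profile_curve[OF open_I interval height_pos dx dy dC dS eq(1)])
        (use eq(2) True in \<open>simp_all add: algebra_simps\<close>)
    show ?thesis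
      by (rule embedded_if_profile_embedded[where \<pi> = "\<lambda>p. (ln ((p $ 1)\<^sup>2 + (p $ 2)\<^sup>2) / 2, p $ 1 / p $ 2)"
            and \<tau> = "\<lambda>p. p $ 3", OF _ _ _ _ profile_embedded[OF disjI2[OF tilted_sign_conditions]]])
        (auto intro!: continuous_intros HR_continuous_intros simp: sweep)
  next
    case False
    define e f :: real where "e = (case \<delta> of C_plus \<Rightarrow> 2 | C_minus \<Rightarrow> - 2 | _ \<Rightarrow> 0)"
      and "f = (if \<delta> = P_type then - 2 else 0)"
    interpret profile_curve I "\<lambda>\<beta>. \<beta>" "\<lambda>\<beta>. \<beta>" "\<lambda>\<beta>. - 1 + e / \<beta>" "\<lambda>\<beta>. f / \<beta>"
      "\<lambda>s. \<gamma> s $ 1" "\<lambda>s. \<gamma> s $ 2" C S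
    proof (rule profile_curveI[OF open_I interval height_pos height_pos _ _ _ dx dy dC dS eq(1)])
      fix s assume s: "s \<in> I"
      have "C s * (w s $ 2 / \<gamma> s $ 2 - (S s)\<^sup>2) - S s * (w s $ 1 / \<gamma> s $ 2 - C s * S s)
          = - C s + 2 * (C s * soliton_field \<delta> (\<gamma> s) $ 2 - S s * soliton_field \<delta> (\<gamma> s) $ 1) / \<gamma> s $ 2"
        using eq(2)[OF s] by simp
      also have "\<dots> = (- 1 + e / \<gamma> s $ 2) * C s + f / \<gamma> s $ 2 * S s"
        using False height_pos[OF s] by (cases \<delta>) (simp_all add: e_def f_def field_simps)
      finally show "C s * (w s $ 2 / \<gamma> s $ 2 - (S s)\<^sup>2) - S s * (w s $ 1 / \<gamma> s $ 2 - C s * S s)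
          = (- 1 + e / \<gamma> s $ 2) * C s + f / \<gamma> s $ 2 * S s" .
    qed (use height_pos in \<open>force intro!: continuous_intros continuous_component\<close>)+
    have "e = 0 \<or> f = 0" by (cases \<delta>) (simp_all add: e_def f_def)
    then show ?thesis
      by (intro embedded_if_profile_embedded[where \<pi> = "\<lambda>p. (p $ 1, p $ 2)" and \<tau> = "\<lambda>p. p $ 3", OF _ _ _ _ profile_embedded])
        (auto intro!: continuous_intros HR_continuous_intros simp: sweep)
  qed
qed

text \<open>For the homotheties the normal component of the field is \<open>C\<close>, which reverses the sign of \<open>\<alpha>\<close>. The coefficient \<open>f\<close> of
  \<open>S\<close> is nonzero for the field \<open>\<partial>\<^sub>z\<close> only, and then \<open>A = - 1\<close> is constant.\<close>

lemma parabolic_embedded: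
  assumes "swept_solution Parabolic \<delta> I c \<gamma> v w"
  shows "embedded_surface (sweep_domain I) (sweep Parabolic c) \<and> no_self_intersections I (generating_curve Parabolic c)"
proof -
  interpret swept_solution Parabolic \<delta> I c \<gamma> v w by fact
  define C S where "C s = v s $ 3" and "S s = v s $ 2 / \<gamma> s $ 2" for s
  note eq = parabolic_equation[OF assms, folded C_def S_def]
  have dz: "((\<lambda>s. \<gamma> s $ 3) has_real_derivative 1 * C s) (at s)"
    and dy: "((\<lambda>s. \<gamma> s $ 2) has_real_derivative \<gamma> s $ 2 * S s) (at s)"
    and dC: "(C has_real_derivative w s $ 3) (at s)" if "s \<in> I" for s
    using deriv[OF that] height_pos[OF that] by (simp_all add: C_def[abs_def] S_def)
  have dS: "(S has_real_derivative w s $ 2 / \<gamma> s $ 2 - (S s)\<^sup>2) (at s)" if s: "s \<in> I" for s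
  proof -
    have "(S has_real_derivative (w s $ 2 * \<gamma> s $ 2 - v s $ 2 * v s $ 2) / (\<gamma> s $ 2 * \<gamma> s $ 2)) (at s)"
      unfolding S_def[abs_def] by (intro DERIV_divide deriv s) (use height_pos[OF s] in simp)
    then show ?thesis using height_pos[OF s] by (simp add: S_def diff_divide_distrib power2_eq_square)
  qed
  have sweep: "sweep Parabolic c q $ 1 = q $ 2" "sweep Parabolic c q $ 2 = \<gamma> (q $ 1) $ 2"
    "sweep Parabolic c q $ 3 = \<gamma> (q $ 1) $ 3" for q
    by (simp_all add: sweep_def \<gamma>_def generating_curve_def)
  define \<alpha> e f :: real where "\<alpha> = (if \<delta> = H_type then 1 else - 1)"
    and "e = (case \<delta> of C_plus \<Rightarrow> 2 | C_minus \<Rightarrow> - 2 | _ \<Rightarrow> 0)"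
    and "f = (if \<delta> = V_type then - 2 else 0)"
  interpret profile_curve I "\<lambda>\<beta>. 1" "\<lambda>\<beta>. \<beta>" "\<lambda>\<beta>. \<alpha> + e / \<beta>" "\<lambda>\<beta>. f"
    "\<lambda>s. \<gamma> s $ 3" "\<lambda>s. \<gamma> s $ 2" C S
  proof (rule profile_curveI[OF open_I interval _ height_pos _ _ _ dz dy dC dS eq(1)])
    fix s assume s: "s \<in> I"
    have "C s * (w s $ 2 / \<gamma> s $ 2 - (S s)\<^sup>2) - S s * w s $ 3
        = - C s + 2 * (C s * soliton_field \<delta> (\<gamma> s) $ 2 / \<gamma> s $ 2 - S s * soliton_field \<delta> (\<gamma> s) $ 3)"
      using eq(2)[OF s] by simp
    also have "\<dots> = (\<alpha> + e / \<gamma> s $ 2) * C s + f * S s"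
      using height_pos[OF s] by (cases \<delta>) (simp_all add: \<alpha>_def e_def f_def field_simps)
    finally show "C s * (w s $ 2 / \<gamma> s $ 2 - (S s)\<^sup>2) - S s * w s $ 3 = (\<alpha> + e / \<gamma> s $ 2) * C s + f * S s" .
  qed (use height_pos in \<open>force intro!: continuous_intros continuous_component\<close>)+
  have "f = 0 \<or> e = 0 \<and> \<alpha> = - 1" by (cases \<delta>) (simp_all add: \<alpha>_def e_def f_def)
  then show ?thesis
    by (intro embedded_if_profile_embedded[where \<pi> = "\<lambda>p. (p $ 3, p $ 2)" and \<tau> = "\<lambda>p. p $ 1", OF _ _ _ _ profile_embedded])
      (auto intro!: continuous_intros HR_continuous_intros simp: sweep)
qed

text \<open>The normal component of \<open>\<partial>\<^sub>x\<close> or \<open>\<plusminus> \<partial>\<^sub>y\<close> at time \<open>t\<close> is proportional to \<open>exp (- t)\<close>, whereas the curvature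
  does not depend on \<open>t\<close>. Both sides of the equation therefore vanish, and only \<open>\<partial>\<^sub>z\<close> contributes a term with
  \<open>S\<close>.\<close>

lemma hyperbolic_embedded:
  assumes "swept_solution Hyperbolic \<delta> I c \<gamma> v w"
  shows "embedded_surface (sweep_domain I) (sweep Hyperbolic c) \<and> no_self_intersections I (generating_curve Hyperbolic c)"
proof -
  interpret swept_solution Hyperbolic \<delta> I c \<gamma> v w by fact
  define x y C S S' where "x s = \<gamma> s $ 1" and "y s = \<gamma> s $ 2" and "C s = v s $ 3"
    and "S s = v s $ 1 - x s * v s $ 2 / y s"
    and "S' s = w s $ 1 - (v s $ 1 * v s $ 2 + x s * w s $ 2) / y s + x s * (v s $ 2)\<^sup>2 / (y s)\<^sup>2" for s
  note eq = hyperbolic_equation[OF assms, folded x_def y_def, folded C_def S_def S'_def]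
  have y: "0 < y s" if "s \<in> I" for s using height_pos[OF that] by (simp add: y_def)
  have sqrt: "sqrt (1 + (x s / y s)\<^sup>2) = 1 / y s" if s: "s \<in> I" for s
  proof (rule real_sqrt_unique)
    show "(1 / y s)\<^sup>2 = 1 + (x s / y s)\<^sup>2"
      using y[OF s] eq(1)[OF s] by (simp add: power_divide field_simps)
  qed (use y[OF s] in simp)
  have dz: "((\<lambda>s. \<gamma> s $ 3) has_real_derivative 1 * C s) (at s)"
    and dC: "(C has_real_derivative w s $ 3) (at s)"
    and dx: "(x has_real_derivative v s $ 1) (at s)" and dy: "(y has_real_derivative v s $ 2) (at s)" if "s \<in> I" for s
    using deriv[OF that] by (simp_all add: C_def[abs_def] x_def[abs_def] y_def[abs_def])
  have db: "((\<lambda>s. x s / y s) has_real_derivative sqrt (1 + (x s / y s)\<^sup>2) * S s) (at s)" if s: "s \<in> I" for s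
  proof -
    have "((\<lambda>s. x s / y s) has_real_derivative (v s $ 1 * y s - x s * v s $ 2) / (y s * y s)) (at s)"
      using y[OF s] by (intro DERIV_divide dx dy s) simp
    moreover have "(v s $ 1 * y s - x s * v s $ 2) / (y s * y s) = 1 / y s * S s"
      using y[OF s] by (simp add: S_def field_simps)
    ultimately show ?thesis unfolding sqrt[OF s] by simp
  qed
  have dS: "(S has_real_derivative S' s) (at s)" if s: "s \<in> I" for s
  proof -
    let ?D = "w s $ 1 - ((v s $ 1 * v s $ 2 + x s * w s $ 2) * y s - x s * v s $ 2 * v s $ 2) / (y s * y s)"
    have "(S has_real_derivative ?D) (at s)"
      unfolding S_def[abs_def] using y[OF s]
      by (auto intro!: derivative_eq_intros dx dy deriv(2) s simp: algebra_simps)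
    moreover have "?D = S' s" using y[OF s] by (simp add: S'_def power2_eq_square field_simps)
    ultimately show ?thesis by simp
  qed
  define f :: real where "f = (if \<delta> = V_type then - 2 else 0)"
  have curvature: "C s * S' s - S s * w s $ 3 = x s * C s + f * S s" if s: "s \<in> I" for s
  proof -
    have sweep: "sweep Hyperbolic c (vector [s, t]) $ 1 = exp t * x s"
      "sweep Hyperbolic c (vector [s, t]) $ 2 = exp t * y s" for t
      by (simp_all add: sweep_def x_def y_def \<gamma>_def)
    \<comment> \<open>compare the times \<open>0\<close> and \<open>ln 2\<close>\<close>
    have fixed: "D = 0" if "\<And>t. L = 2 * (D / (exp t * y s))" for L D :: real
    proof -
      have "L = 2 * (D / y s)" "L = 2 * (D / (2 * y s))" using that[of 0] that[of "ln 2"] by simp_all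
      then show ?thesis using y[OF s] by (simp add: field_simps)
    qed
    show ?thesis
    proof (cases \<delta>)
      case V_type
      then show ?thesis using eq(5)[OF s, of 0] by (simp add: f_def)
    next
      case H_type
      then show ?thesis using eq(5)[OF s, of 0] by (simp add: f_def sweep)
    next
      case P_type
      have "C s * S' s - S s * w s $ 3 - x s * C s = 2 * ((C s * y s) / (exp t * y s))" for t
        using eq(5)[OF s, of t] P_type by simp
      moreover from fixed[OF this] have "C s * y s = 0" .
      ultimately show ?thesis by (simp add: f_def P_type)
    next
      case C_plus
      have "C s * S' s - S s * w s $ 3 - x s * C s = 2 * (- (C s * x s) / (exp t * y s))" for t
        using eq(5)[OF s, of t] C_plus by simp
      moreover from fixed[OF this] have "C s * x s = 0" by simp
      ultimately show ?thesis by (simp add: f_def C_plus)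
    next
      case C_minus
      have "C s * S' s - S s * w s $ 3 - x s * C s = 2 * ((C s * x s) / (exp t * y s))" for t
        using eq(5)[OF s, of t] C_minus by simp
      moreover from fixed[OF this] have "C s * x s = 0" .
      ultimately show ?thesis by (simp add: f_def C_minus)
    qed
  qed
  have cont_b: "continuous_on I (\<lambda>s. x s / y s)"
    by (intro continuous_at_imp_continuous_on ballI DERIV_isCont[OF db])
  interpret profile_curve I "\<lambda>\<beta>. 1" "\<lambda>\<beta>. sqrt (1 + \<beta>\<^sup>2)" "\<lambda>\<beta>. \<beta> / sqrt (1 + \<beta>\<^sup>2)" "\<lambda>\<beta>. f"
    "\<lambda>s. \<gamma> s $ 3" "\<lambda>s. x s / y s" C S
  proof (rule profile_curveI[OF open_I interval _ _ _ _ _ dz db dC dS eq(4)])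
    fix s assume s: "s \<in> I"
    show "0 < sqrt (1 + (x s / y s)\<^sup>2)" unfolding sqrt[OF s] using y[OF s] by simp
    show "C s * S' s - S s * w s $ 3 = x s / y s / sqrt (1 + (x s / y s)\<^sup>2) * C s + f * S s"
      unfolding sqrt[OF s] curvature[OF s] using y[OF s] by simp
  next
    have nz: "sqrt (1 + r\<^sup>2) \<noteq> 0" for r :: real by (simp add: add_nonneg_eq_0_iff)
    show "continuous_on I (\<lambda>s. sqrt (1 + (x s / y s)\<^sup>2))"
      "continuous_on I (\<lambda>s. x s / y s / sqrt (1 + (x s / y s)\<^sup>2))"
      by (intro continuous_intros cont_b ballI nz)+
  qed simp_all
  have sweep: "sweep Hyperbolic c q $ 1 = exp (q $ 2) * x (q $ 1)"
      "sweep Hyperbolic c q $ 2 = exp (q $ 2) * y (q $ 1)" "sweep Hyperbolic c q $ 3 = \<gamma> (q $ 1) $ 3" for q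
    by (simp_all add: sweep_def x_def y_def \<gamma>_def)
  show ?thesis
  proof (rule embedded_if_profile_embedded[where \<pi> = "\<lambda>p. (p $ 3, p $ 1 / p $ 2)"
        and \<tau> = "\<lambda>p. ln ((p $ 1)\<^sup>2 + (p $ 2)\<^sup>2) / 2", OF _ _ _ _ profile_embedded[OF disjI2[OF tilted_sign_conditions]]])
    show "continuous_on HR (\<lambda>p. (p $ 3, p $ 1 / p $ 2))" "continuous_on HR (\<lambda>p. ln ((p $ 1)\<^sup>2 + (p $ 2)\<^sup>2) / 2)"
      by (auto intro!: continuous_intros HR_continuous_intros)
    fix q assume "q \<in> sweep_domain I"
    then have s: "q $ 1 \<in> I" by (simp add: sweep_domain_def)
    show "(sweep Hyperbolic c q $ 3, sweep Hyperbolic c q $ 1 / sweep Hyperbolic c q $ 2) = (\<gamma> (q $ 1) $ 3, x (q $ 1) / y (q $ 1))"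
      by (simp add: sweep)
    have "(sweep Hyperbolic c q $ 1)\<^sup>2 + (sweep Hyperbolic c q $ 2)\<^sup>2 = (exp (q $ 2))\<^sup>2 * ((x (q $ 1))\<^sup>2 + (y (q $ 1))\<^sup>2)"
      by (simp add: sweep power_mult_distrib algebra_simps)
    also have "\<dots> = exp (2 * q $ 2)" using eq(1)[OF s] by (simp add: exp_double)
    finally show "ln ((sweep Hyperbolic c q $ 1)\<^sup>2 + (sweep Hyperbolic c q $ 2)\<^sup>2) / 2 = q $ 2" by simp
  qed
qed

theorem theorem1p4:
  fixes G :: translation_type and \<delta> :: soliton_type
    and I :: "real set" and c :: "real \<Rightarrow> real^2"
  assumes "grim_reaper G \<delta> I c"
  shows "embedded_surface (sweep_domain I) (sweep G c) \<and>
    no_self_intersections I (generating_curve G c)"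
proof -
  have gen: "generating_solution G \<delta> I c" using assms by (simp add: grim_reaper_def)
  then have "open I" "smooth_on (sweep_domain I) (sweep G c)"
    by (simp_all add: generating_solution_def soliton_def immersed_surface_def)
  then obtain v w where "\<And>s. s \<in> I \<Longrightarrow> (generating_curve G c has_vector_derivative v s) (at s)"
    "\<And>s. s \<in> I \<Longrightarrow> (v has_vector_derivative w s) (at s)"
    using generating_curve_derivatives by blast
  with gen have "swept_solution G \<delta> I c (generating_curve G c) v w"
    by unfold_locales auto
  then show ?thesis
    using vertical_embedded parabolic_embedded hyperbolic_embedded by (cases G) blast+
qed

end
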